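(* Let $\Bbbk$ be a commutative ring with unit and let $n\geq 0$ be an integer. There is an isomorphism $\varphi\colon \Bbbk C_{n+1}\to I(P_n,\Bbbk)$ of $\Bbbk$-algebras, from the monoid algebra of the Catalan monoid $C_{n+1}$ to the incidence algebra of the poset $P_n$, given on the basis $C_{n+1}$ by \[\varphi(f) = \sum_{S\in \mathsf{PCS}(f)} (S,f(S))\] for $f\in C_{n+1}$.
   Context: For an integer $m\ge 0$, $[m]=\{1,\ldots,m\}$ (so $[0]=\emptyset$). The Catalan monoid $C_{n+1}$ is the monoid, under composition $(fg)(i)=f(g(i))$, of all maps $f\colon [n+1]\to[n+1]$ that are order-preserving ($i\le j$ implies $f(i)\le f(j)$) and weakly increasing (meaning $i\le f(i)$ for all $i\in[n+1]$). $\Bbbk C_{n+1}$ denotes its monoid algebra over $\Bbbk$, the free $\Bbbk$-module with basis $C_{n+1}$ and multiplication extending that of $C_{n+1}$ bilinearly. $P_n$ is the poset of all subsets of $[n]$, ordered by: $X\leq Y$ if and only if $|X|=|Y|$ and, writing $X=\{x_1<\cdots<x_k\}$ and $Y=\{y_1<\cdots<y_k\}$, one has $x_i\leq y_i$ for $i=1,\ldots,k$. $I(P_n,\Bbbk)$, the incidence algebra of $P_n$ over $\Bbbk$, is the $\Bbbk$-algebra that is free as a $\Bbbk$-module with basis all ordered pairs $(X,Y)$ with $X\leq Y$ in $P_n$, with product defined on basis elements by $(U,V)(X,Y)=(X,V)$ if $Y=U$, and $(U,V)(X,Y)=0$ otherwise (its identity is $\sum_{X\in P_n}(X,X)$). A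 subset $S\subseteq[n]$ is a partial cross-section for $f\in C_{n+1}$ if $n+1\notin f(S)$ and $f|_S$ is injective, i.e., $|S|=|f(S)|$. $\mathsf{PCS}(f)$ denotes the set of all partial cross-sections of $f$. *)

theory Defs
  imports "HOL-Algebra.Module" "HOL-Algebra.QuotRing"
begin

section \<open>Algebras over a commutative ring\<close>

text \<open>
  The library locale \<^locale>\<open>algebra\<close> requires the multiplication to be commutative, so the
  general notion of an associative unital algebra is introduced here.
\<close>

locale assoc_algebra = module R A + ring A for R (structure) and A (structure) +
  assumes smult_mult_left:
      "\<lbrakk>r \<in> carrier R; x \<in> carrier A; y \<in> carrier A\<rbrakk>
        \<Longrightarrow> (r \<odot>\<^bsub>A\<^esub> x) \<otimes>\<^bsub>A\<^esub> y = r \<odot>\<^bsub>A\<^esub> (x \<otimes>\<^bsub>A\<^esub> y)"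
    and smult_mult_right:
      "\<lbrakk>r \<in> carrier R; x \<in> carrier A; y \<in> carrier A\<rbrakk>
        \<Longrightarrow> x \<otimes>\<^bsub>A\<^esub> (r \<odot>\<^bsub>A\<^esub> y) = r \<odot>\<^bsub>A\<^esub> (x \<otimes>\<^bsub>A\<^esub> y)"

definition algebra_iso ::
  "('r, 's) ring_scheme \<Rightarrow> ('r, 'a, 't) module_scheme \<Rightarrow> ('r, 'b, 'u) module_scheme \<Rightarrow> ('a \<Rightarrow> 'b) \<Rightarrow> bool"
where
  "algebra_iso R A B \<phi> \<longleftrightarrow>
     assoc_algebra R A \<and> assoc_algebra R B \<and> \<phi> \<in> ring_iso A B \<and>
     (\<forall>r\<in>carrier R. \<forall>x\<in>carrier A. \<phi> (r \<odot>\<^bsub>A\<^esub> x) = r \<odot>\<^bsub>B\<^esub> \<phi> x)"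


section \<open>Algebras given by a multiplication on a basis\<close>

text \<open>
  An element of the free module with basis \<open>B\<close> is its coefficient function \<open>B \<rightarrow> R\<close> (extensional,
  of finite support). The multiplication is the bilinear extension of a partial operation \<open>m\<close> on
  the basis, where \<open>m a b = None\<close> means that the product of the basis elements \<open>a\<close> and \<open>b\<close> is zero.
\<close>

definition coeff_supp :: "('r, 's) ring_scheme \<Rightarrow> 'b set \<Rightarrow> ('b \<Rightarrow> 'r) \<Rightarrow> 'b set" where
  "coeff_supp R B u = {b \<in> B. u b \<noteq> \<zero>\<^bsub>R\<^esub>}"

definition basis_vec :: "('r, 's) ring_scheme \<Rightarrow> 'b set \<Rightarrow> 'b \<Rightarrow> ('b \<Rightarrow> 'r)" where
  "basis_vec R B b = (\<lambda>c\<in>B. if c = b then \<one>\<^bsub>R\<^esub> else \<zero>\<^bsub>R\<^esub>)"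

definition basis_algebra ::
  "('r, 's) ring_scheme \<Rightarrow> 'b set \<Rightarrow> ('b \<Rightarrow> 'b \<Rightarrow> 'b option) \<Rightarrow> ('b \<Rightarrow> 'r) \<Rightarrow> ('r, 'b \<Rightarrow> 'r) module"
where
  "basis_algebra R B m e =
    \<lparr> carrier = {u \<in> B \<rightarrow>\<^sub>E carrier R. finite (coeff_supp R B u)},
      mult = (\<lambda>u v. \<lambda>c\<in>B. \<Oplus>\<^bsub>R\<^esub>a\<in>coeff_supp R B u. \<Oplus>\<^bsub>R\<^esub>b\<in>coeff_supp R B v.
                if m a b = Some c then u a \<otimes>\<^bsub>R\<^esub> v b else \<zero>\<^bsub>R\<^esub>),
      one = e,
      zero = (\<lambda>b\<in>B. \<zero>\<^bsub>R\<^esub>),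
      add = (\<lambda>u v. \<lambda>b\<in>B. u b \<oplus>\<^bsub>R\<^esub> v b),
      smult = (\<lambda>r u. \<lambda>b\<in>B. r \<otimes>\<^bsub>R\<^esub> u b) \<rparr>"

definition monoid_algebra ::
  "('r, 's) ring_scheme \<Rightarrow> ('b, 't) monoid_scheme \<Rightarrow> ('r, 'b \<Rightarrow> 'r) module"
where
  "monoid_algebra R M =
    basis_algebra R (carrier M) (\<lambda>a b. Some (a \<otimes>\<^bsub>M\<^esub> b)) (basis_vec R (carrier M) \<one>\<^bsub>M\<^esub>)"

definition incidence_pairs :: "('p, 's) gorder_scheme \<Rightarrow> ('p \<times> 'p) set" where
  "incidence_pairs L = {(X, Y). X \<in> carrier L \<and> Y \<in> carrier L \<and> X \<sqsubseteq>\<^bsub>L\<^esub> Y}"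

text \<open>
  Intended for posets with finite carrier. The unit is the sum of all \<open>(X, X)\<close>; the product
  \<open>(U, V)(X, Y)\<close> is read from right to left, like the composition of maps.
\<close>

definition incidence_algebra ::
  "('r, 's) ring_scheme \<Rightarrow> ('p, 't) gorder_scheme \<Rightarrow> ('r, 'p \<times> 'p \<Rightarrow> 'r) module"
where
  "incidence_algebra R L =
    basis_algebra R (incidence_pairs L)
      (\<lambda>(U, V) (X, Y). if Y = U then Some (X, V) else None)
      (\<lambda>(X, Y)\<in>incidence_pairs L. if X = Y then \<one>\<^bsub>R\<^esub> else \<zero>\<^bsub>R\<^esub>)"


section \<open>The Catalan monoid, the poset of subsets, and partial cross-sections\<close>

text \<open>
  \<open>catalan_monoid m\<close> is the monoid of maps on \<open>{1..m}\<close>; maps are made extensional so that equality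
  in HOL is equality on \<open>{1..m}\<close>.
\<close>

definition catalan_monoid :: "nat \<Rightarrow> (nat \<Rightarrow> nat) monoid" where
  "catalan_monoid m =
    \<lparr> carrier = {f \<in> {1..m} \<rightarrow>\<^sub>E {1..m}. mono_on {1..m} f \<and> (\<forall>i\<in>{1..m}. i \<le> f i)},
      mult = (\<lambda>f g. compose {1..m} f g),
      one = (\<lambda>i\<in>{1..m}. i) \<rparr>"

definition subset_poset :: "nat \<Rightarrow> nat set gorder" where
  "subset_poset n =
    \<lparr> carrier = Pow {1..n},
      eq = (=),
      le = (\<lambda>X Y. card X = card Y \<and>
              (\<forall>i<card X. sorted_list_of_set X ! i \<le> sorted_list_of_set Y ! i)) \<rparr>"

text \<open>The parameter \<open>n\<close> refers to maps \<open>f\<close> on \<open>{1..n+1}\<close>.\<close>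

definition PCS :: "nat \<Rightarrow> (nat \<Rightarrow> nat) \<Rightarrow> nat set set" where
  "PCS n f = {S. S \<subseteq> {1..n} \<and> n + 1 \<notin> f ` S \<and> inj_on f S}"


section \<open>Well-definedness\<close>

lemma catalan_monoid_monoid: "monoid (catalan_monoid m)"
proof (rule monoidI)
  fix f g assume "f \<in> carrier (catalan_monoid m)" "g \<in> carrier (catalan_monoid m)"
  then have f: "f \<in> {1..m} \<rightarrow>\<^sub>E {1..m}" "mono_on {1..m} f" "\<forall>i\<in>{1..m}. i \<le> f i"
    and g: "g \<in> {1..m} \<rightarrow>\<^sub>E {1..m}" "mono_on {1..m} g" "\<forall>i\<in>{1..m}. i \<le> g i"
    by (auto simp: catalan_monoid_def)
  have gin: "g i \<in> {1..m}" if "i \<in> {1..m}" for i using g(1) that by (rule PiE_mem)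
  have fin: "f i \<in> {1..m}" if "i \<in> {1..m}" for i using f(1) that by (rule PiE_mem)
  have "compose {1..m} f g \<in> {1..m} \<rightarrow>\<^sub>E {1..m}"
    using fin gin by (auto simp: compose_def simp del: atLeastAtMost_iff)
  moreover have "mono_on {1..m} (compose {1..m} f g)"
    using f(2) g(2) gin by (auto intro!: monotone_onI simp: compose_eq monotone_on_def simp del: atLeastAtMost_iff)
  moreover have "\<forall>i\<in>{1..m}. i \<le> compose {1..m} f g i"
    using f(3) g(3) gin by (auto simp: compose_eq simp del: atLeastAtMost_iff intro: order_trans)
  ultimately show "f \<otimes>\<^bsub>catalan_monoid m\<^esub> g \<in> carrier (catalan_monoid m)"
    by (simp add: catalan_monoid_def)
next
  show "\<one>\<^bsub>catalan_monoid m\<^esub> \<in> carrier (catalan_monoid m)"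
    by (auto simp: catalan_monoid_def monotone_on_def)
next
  fix f g h
  assume "f \<in> carrier (catalan_monoid m)" "g \<in> carrier (catalan_monoid m)" "h \<in> carrier (catalan_monoid m)"
  then have "h \<in> {1..m} \<rightarrow> {1..m}"
    by (auto simp: catalan_monoid_def PiE_def simp del: atLeastAtMost_iff)
  then show "f \<otimes>\<^bsub>catalan_monoid m\<^esub> g \<otimes>\<^bsub>catalan_monoid m\<^esub> h
           = f \<otimes>\<^bsub>catalan_monoid m\<^esub> (g \<otimes>\<^bsub>catalan_monoid m\<^esub> h)"
    by (simp add: catalan_monoid_def compose_assoc[where B="{1..m}"])
next
  fix f assume "f \<in> carrier (catalan_monoid m)"
  then have "f \<in> {1..m} \<rightarrow> {1..m}" "f \<in> extensional {1..m}"
    by (auto simp: catalan_monoid_def PiE_def)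
  then show "\<one>\<^bsub>catalan_monoid m\<^esub> \<otimes>\<^bsub>catalan_monoid m\<^esub> f = f"
    "f \<otimes>\<^bsub>catalan_monoid m\<^esub> \<one>\<^bsub>catalan_monoid m\<^esub> = f"
    by (simp_all add: catalan_monoid_def Id_compose compose_Id)
qed

lemma subset_poset_partial_order: "partial_order (subset_poset n)"
proof (intro partial_order.intro weak_partial_order.intro)
  show "equivalence (subset_poset n)"
    by (rule equivalence.intro) (auto simp: subset_poset_def)
  have anti: "X = Y" if "X \<sqsubseteq>\<^bsub>subset_poset n\<^esub> Y" "Y \<sqsubseteq>\<^bsub>subset_poset n\<^esub> X"
    "X \<in> carrier (subset_poset n)" "Y \<in> carrier (subset_poset n)" for X Y
  proof -
    have fin: "finite X" "finite Y"
      using that by (auto simp: subset_poset_def intro: finite_subset)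
    have "sorted_list_of_set X = sorted_list_of_set Y"
      using that by (intro nth_equalityI) (auto simp: subset_poset_def intro: antisym)
    then show ?thesis using fin by (metis set_sorted_list_of_set)
  qed
  show "weak_partial_order_axioms (subset_poset n)"
    using anti
    by (intro weak_partial_order_axioms.intro) (auto simp: subset_poset_def, metis order_trans)
  show "partial_order_axioms (subset_poset n)"
    by (rule partial_order_axioms.intro) (auto simp: subset_poset_def)
qed

text \<open>The pairs occurring in the isomorphism are basis elements of the incidence algebra.\<close>

lemma PCS_incidence_pairs:
  assumes f: "f \<in> carrier (catalan_monoid (n + 1))" and S: "S \<in> PCS n f"
  shows "(S, f ` S) \<in> incidence_pairs (subset_poset n)"
proof -
  have Sn: "S \<subseteq> {1..n}" and inj: "inj_on f S" and top: "n + 1 \<notin> f ` S"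
    using S by (auto simp: PCS_def)
  have fin: "finite S" using Sn finite_subset by blast
  have f1: "f i \<in> {1..n+1}" "i \<le> f i" if "i \<in> S" for i
    using f that Sn by (auto simp: catalan_monoid_def PiE_iff subset_iff)
  have f2: "f i \<le> f j" if "i \<in> S" "j \<in> S" "i \<le> j" for i j
  proof -
    have "i \<in> {1..n+1}" "j \<in> {1..n+1}" using that Sn by auto
    then show ?thesis
      using f that(3) by (auto simp: catalan_monoid_def intro: monotone_onD simp del: atLeastAtMost_iff)
  qed
  have "f i \<in> {1..n}" if "i \<in> S" for i
    using f1(1)[OF that] top that by (metis atLeastAtMost_iff image_eqI le_eq_less_or_eq less_Suc_eq_le Suc_eq_plus1)
  then have im: "f ` S \<subseteq> {1..n}" by blast
  have card: "card (f ` S) = card S" by (rule card_image[OF inj])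
  have "sorted_wrt (<) (map f (sorted_list_of_set S))"
  proof (unfold sorted_wrt_map, rule sorted_wrt_mono_rel[OF _ strict_sorted_list_of_set[of S]])
    fix x y assume "x \<in> set (sorted_list_of_set S)" "y \<in> set (sorted_list_of_set S)" "x < y"
    then show "f x < f y"
      using fin f2[of x y] inj by (auto simp: inj_on_def le_less)
  qed
  moreover have "set (map f (sorted_list_of_set S)) = f ` S" using fin by simp
  ultimately have "sorted_list_of_set (f ` S) = map f (sorted_list_of_set S)"
    by (metis sorted_list_of_set.idem_if_sorted_distinct strict_sorted_iff)
  moreover have "sorted_list_of_set S ! i \<in> S" if "i < card S" for i
    using that fin nth_mem[of i "sorted_list_of_set S"] by simp
  ultimately have "\<forall>i<card S. sorted_list_of_set S ! i \<le> sorted_list_of_set (f ` S) ! i"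
    using f1(2) by simp
  then show ?thesis
    using Sn im card by (simp add: incidence_pairs_def subset_poset_def)
qed

lemma (in comm_monoid) finprod_swap_double:
  assumes "finite A" "finite B" "\<And>a b. a \<in> A \<Longrightarrow> b \<in> B \<Longrightarrow> f a b \<in> carrier G"
  shows "(\<Otimes>a\<in>A. \<Otimes>b\<in>B. f a b) = (\<Otimes>b\<in>B. \<Otimes>a\<in>A. f a b)"
  using assms(1,3)
proof (induction A)
  case (insert x F)
  have "(\<Otimes>b\<in>B. \<Otimes>a\<in>insert x F. f a b) = (\<Otimes>b\<in>B. f x b \<otimes> (\<Otimes>a\<in>F. f a b))"
    using insert by (intro finprod_cong') (auto intro!: finprod_insert finprod_closed)
  also have "\<dots> = (\<Otimes>b\<in>B. f x b) \<otimes> (\<Otimes>b\<in>B. \<Otimes>a\<in>F. f a b)"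
    using insert by (intro finprod_multf) (auto intro!: finprod_closed)
  finally show ?case
    using insert by (subst finprod_insert) (auto intro!: finprod_closed)
qed simp

lemma (in abelian_monoid) finsum_swap_double:
  assumes "finite A" "finite B" "\<And>a b. a \<in> A \<Longrightarrow> b \<in> B \<Longrightarrow> f a b \<in> carrier G"
  shows "(\<Oplus>a\<in>A. \<Oplus>b\<in>B. f a b) = (\<Oplus>b\<in>B. \<Oplus>a\<in>A. f a b)"
  using add.finprod_swap_double[OF assms(1,2), of f] assms(3) by simp

lemma (in abelian_monoid) finsum_delta_option:
  assumes "finite T" "\<And>x. x \<in> T \<Longrightarrow> g x \<in> carrier G" "\<And>x. z = Some x \<Longrightarrow> x \<in> T"
  shows "(\<Oplus>x\<in>T. if z = Some x then g x else \<zero>) = (case z of None \<Rightarrow> \<zero> | Some x \<Rightarrow> g x)"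
proof (cases z)
  case None
  then show ?thesis by (simp add: finsum_zero)
next
  case (Some y)
  then have "y \<in> T" using assms(3) by blast
  have "(\<Oplus>x\<in>T. if z = Some x then g x else \<zero>) = (\<Oplus>x\<in>T. if y = x then g x else \<zero>)"
    using Some by simp
  also have "\<dots> = g y"
    using \<open>y \<in> T\<close> assms(1,2) by (intro finsum_singleton) auto
  finally show ?thesis using Some by simp
qed

locale basis_algebra_setup = cring R for R (structure) and B :: "'b set" and m and E +
  assumes m_closed_basis: "\<lbrakk>a \<in> B; b \<in> B; m a b = Some c\<rbrakk> \<Longrightarrow> c \<in> B"
    and m_assoc_basis: "\<lbrakk>a \<in> B; b \<in> B; c \<in> B\<rbrakk>
      \<Longrightarrow> Option.bind (m a b) (\<lambda>x. m x c) = Option.bind (m b c) (\<lambda>y. m a y)"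
    and E: "finite E" "E \<subseteq> B"
    and E_left: "b \<in> B \<Longrightarrow> \<exists>x\<in>E. \<forall>a\<in>E. m a b = (if a = x then Some b else None)"
    and E_right: "b \<in> B \<Longrightarrow> \<exists>x\<in>E. \<forall>a\<in>E. m b a = (if a = x then Some b else None)"
begin

abbreviation "S \<equiv> coeff_supp R B"
abbreviation "A \<equiv> basis_algebra R B m (\<lambda>c\<in>B. if c \<in> E then \<one> else \<zero>)"

lemma carrier_A: "u \<in> carrier A \<longleftrightarrow> u \<in> B \<rightarrow>\<^sub>E carrier R \<and> finite (S u)"
  by (simp add: basis_algebra_def)

lemma A_coeff: "u \<in> carrier A \<Longrightarrow> b \<in> B \<Longrightarrow> u b \<in> carrier R"
  by (auto simp: carrier_A)

lemma A_fin: "u \<in> carrier A \<Longrightarrow> finite (S u)"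
  by (auto simp: carrier_A)

lemma S_sub: "S u \<subseteq> B"
  by (auto simp: coeff_supp_def)

lemma A_eqI: "u \<in> carrier A \<Longrightarrow> v \<in> carrier A \<Longrightarrow> (\<And>b. b \<in> B \<Longrightarrow> u b = v b) \<Longrightarrow> u = v"
  unfolding carrier_A by (blast intro: PiE_ext)

lemma A_carrierI:
  assumes "finite T" "\<And>b. b \<in> B \<Longrightarrow> f b \<in> carrier R" "\<And>b. b \<in> B \<Longrightarrow> b \<notin> T \<Longrightarrow> f b = \<zero>"
  shows "(\<lambda>b\<in>B. f b) \<in> carrier A"
proof -
  have "S (\<lambda>b\<in>B. f b) \<subseteq> T" using assms(3) by (auto simp: coeff_supp_def)
  then show ?thesis using assms(1,2) by (auto simp: carrier_A intro: finite_subset)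
qed

lemma A_add: "b \<in> B \<Longrightarrow> (u \<oplus>\<^bsub>A\<^esub> v) b = u b \<oplus> v b"
  and A_smult: "b \<in> B \<Longrightarrow> (r \<odot>\<^bsub>A\<^esub> u) b = r \<otimes> u b"
  and A_zero: "b \<in> B \<Longrightarrow> \<zero>\<^bsub>A\<^esub> b = \<zero>"
  and A_one: "b \<in> B \<Longrightarrow> \<one>\<^bsub>A\<^esub> b = (if b \<in> E then \<one> else \<zero>)"
  by (simp_all add: basis_algebra_def)

lemma S_zero: "b \<in> B \<Longrightarrow> b \<notin> S u \<Longrightarrow> u b = \<zero>"
  by (simp add: coeff_supp_def)

lemma add_closed_A:
  assumes "u \<in> carrier A" "v \<in> carrier A" shows "u \<oplus>\<^bsub>A\<^esub> v \<in> carrier A"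
proof -
  have "(\<lambda>b\<in>B. u b \<oplus> v b) \<in> carrier A"
    using assms by (intro A_carrierI[of "S u \<union> S v"]) (auto intro: A_fin A_coeff simp: S_zero)
  then show ?thesis by (simp add: basis_algebra_def)
qed

lemma smult_closed_A:
  assumes "r \<in> carrier R" "u \<in> carrier A" shows "r \<odot>\<^bsub>A\<^esub> u \<in> carrier A"
proof -
  have "(\<lambda>b\<in>B. r \<otimes> u b) \<in> carrier A"
    using assms by (intro A_carrierI[of "S u"]) (auto intro: A_fin A_coeff simp: S_zero)
  then show ?thesis by (simp add: basis_algebra_def)
qed

lemma zero_closed_A: "\<zero>\<^bsub>A\<^esub> \<in> carrier A"
  using A_carrierI[of "{}" "\<lambda>b. \<zero>"] by (simp add: basis_algebra_def)

lemma one_closed_A: "\<one>\<^bsub>A\<^esub> \<in> carrier A"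
  using A_carrierI[of E "\<lambda>c. if c \<in> E then \<one> else \<zero>"] E by (simp add: basis_algebra_def)

lemma abelian_group_A: "abelian_group A"
proof (rule abelian_groupI)
  fix u assume u: "u \<in> carrier A"
  have "(\<ominus> \<one>) \<odot>\<^bsub>A\<^esub> u \<oplus>\<^bsub>A\<^esub> u = \<zero>\<^bsub>A\<^esub>"
    using u by (intro A_eqI add_closed_A smult_closed_A zero_closed_A)
      (auto simp: A_add A_smult A_zero A_coeff l_minus l_neg)
  then show "\<exists>y\<in>carrier A. y \<oplus>\<^bsub>A\<^esub> u = \<zero>\<^bsub>A\<^esub>"
    using u smult_closed_A by (metis a_inv_closed one_closed)
next
  show "u \<oplus>\<^bsub>A\<^esub> v \<oplus>\<^bsub>A\<^esub> w = u \<oplus>\<^bsub>A\<^esub> (v \<oplus>\<^bsub>A\<^esub> w)"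
    if "u \<in> carrier A" "v \<in> carrier A" "w \<in> carrier A" for u v w
    using that by (intro A_eqI add_closed_A) (simp_all add: A_add A_coeff a_assoc)
  show "u \<oplus>\<^bsub>A\<^esub> v = v \<oplus>\<^bsub>A\<^esub> u" if "u \<in> carrier A" "v \<in> carrier A" for u v
    using that by (intro A_eqI add_closed_A) (simp_all add: A_add A_coeff a_comm)
  show "\<zero>\<^bsub>A\<^esub> \<oplus>\<^bsub>A\<^esub> u = u" if "u \<in> carrier A" for u
    using that by (intro A_eqI add_closed_A zero_closed_A) (simp_all add: A_add A_zero A_coeff)
qed (intro add_closed_A zero_closed_A; assumption)+

lemma module_A: "module R A"
proof (rule moduleI[OF is_cring abelian_group_A])
  show "r \<odot>\<^bsub>A\<^esub> u \<in> carrier A"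
    if "r \<in> carrier R" "u \<in> carrier A" for r u
    using that by (rule smult_closed_A)
  show "(r \<oplus> s) \<odot>\<^bsub>A\<^esub> u = r \<odot>\<^bsub>A\<^esub> u \<oplus>\<^bsub>A\<^esub> s \<odot>\<^bsub>A\<^esub> u"
    if "r \<in> carrier R" "s \<in> carrier R" "u \<in> carrier A" for r s u
    using that by (intro A_eqI add_closed_A smult_closed_A a_closed)
      (simp_all add: A_add A_smult A_coeff l_distr)
  show "r \<odot>\<^bsub>A\<^esub> (u \<oplus>\<^bsub>A\<^esub> v) = r \<odot>\<^bsub>A\<^esub> u \<oplus>\<^bsub>A\<^esub> r \<odot>\<^bsub>A\<^esub> v"
    if "r \<in> carrier R" "u \<in> carrier A" "v \<in> carrier A" for r u v
    using that by (intro A_eqI add_closed_A smult_closed_A)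
      (simp_all add: A_add A_smult A_coeff r_distr)
  show "(r \<otimes> s) \<odot>\<^bsub>A\<^esub> u = r \<odot>\<^bsub>A\<^esub> (s \<odot>\<^bsub>A\<^esub> u)"
    if "r \<in> carrier R" "s \<in> carrier R" "u \<in> carrier A" for r s u
    using that by (intro A_eqI smult_closed_A m_closed)
      (simp_all add: A_smult A_coeff m_assoc)
  show "\<one> \<odot>\<^bsub>A\<^esub> u = u"
    if "u \<in> carrier A" for u
    using that by (intro A_eqI smult_closed_A one_closed)
      (simp_all add: A_smult A_coeff)
qed

definition P where
  "P T T' u v c = (\<Oplus>a\<in>T. \<Oplus>b\<in>T'. if m a b = Some c then u a \<otimes> v b else \<zero>)"

definition W where "W T T' = {c \<in> B. \<exists>a\<in>T. \<exists>b\<in>T'. m a b = Some c}"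

lemma finite_W: "finite T \<Longrightarrow> finite T' \<Longrightarrow> finite (W T T')"
proof (rule finite_subset)
  show "W T T' \<subseteq> (\<lambda>(a, b). the (m a b)) ` (T \<times> T')"
    unfolding W_def by force
qed auto

lemma W_sub: "W T T' \<subseteq> B"
  by (auto simp: W_def)

lemma P_closed:
  assumes "u \<in> carrier A" "v \<in> carrier A" "T \<subseteq> B" "T' \<subseteq> B"
  shows "P T T' u v c \<in> carrier R"
  using assms unfolding P_def by (intro finsum_closed) (auto intro!: finsum_closed simp: A_coeff subset_iff)

lemma P_zero: "c \<in> B \<Longrightarrow> c \<notin> W T T' \<Longrightarrow> P T T' u v c = \<zero>"
proof -
  assume c: "c \<in> B" "c \<notin> W T T'"
  have "P T T' u v c = (\<Oplus>a\<in>T. \<Oplus>b\<in>T'. \<zero>)"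
    unfolding P_def using c by (intro finsum_cong') (auto simp: W_def intro!: finsum_cong')
  then show ?thesis by (simp add: finsum_zero)
qed

lemma P_mono:
  assumes u: "u \<in> carrier A" "v \<in> carrier A"
    and T: "S u \<subseteq> T" "T \<subseteq> B" "finite T" and T': "S v \<subseteq> T'" "T' \<subseteq> B" "finite T'"
  shows "P (S u) (S v) u v c = P T T' u v c"
proof -
  have z: "u a = \<zero>" if "a \<in> T - S u" for a using that T S_zero by blast
  have z': "v a = \<zero>" if "a \<in> T' - S v" for a using that T' S_zero by blast
  have cl: "u a \<in> carrier R" if "a \<in> T" for a using that T u A_coeff by blast
  have cl': "v a \<in> carrier R" if "a \<in> T'" for a using that T' u A_coeff by blast
  have "P (S u) (S v) u v c = P (S u) T' u v c"
    unfolding P_def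
  proof (rule finsum_cong'[OF refl])
    show "(\<Oplus>b\<in>S v. if m a b = Some c then u a \<otimes> v b else \<zero>)
        = (\<Oplus>b\<in>T'. if m a b = Some c then u a \<otimes> v b else \<zero>)" if "a \<in> S u" for a
      using that T T' cl cl' z' 
      by (intro add.finprod_mono_neutral_cong_left) (auto simp: subset_iff)
  qed (use T T' cl cl' in \<open>auto intro!: finsum_closed\<close>)
  also have "\<dots> = P T T' u v c"
    unfolding P_def
  proof (intro add.finprod_mono_neutral_cong_left)
    show "(\<Oplus>b\<in>T'. if m a b = Some c then u a \<otimes> v b else \<zero>) = \<zero>" if "a \<in> T - S u" for a
      using z[OF that] cl' by (intro add.finprod_one_eqI) auto
  qed (use T T' cl cl' in \<open>auto intro!: finsum_closed\<close>)
  finally show ?thesis .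
qed

lemma A_mult:
  assumes "u \<in> carrier A" "v \<in> carrier A"
    and "S u \<subseteq> T" "T \<subseteq> B" "finite T" "S v \<subseteq> T'" "T' \<subseteq> B" "finite T'" "c \<in> B"
  shows "(u \<otimes>\<^bsub>A\<^esub> v) c = P T T' u v c"
  using P_mono[OF assms(1-8)] assms(9) by (simp add: basis_algebra_def P_def)

lemma A_mult': "c \<in> B \<Longrightarrow> (u \<otimes>\<^bsub>A\<^esub> v) c = P (S u) (S v) u v c"
  by (simp add: basis_algebra_def P_def)

lemma mult_closed_A:
  assumes "u \<in> carrier A" "v \<in> carrier A" shows "u \<otimes>\<^bsub>A\<^esub> v \<in> carrier A"
proof -
  have "(\<lambda>c\<in>B. P (S u) (S v) u v c) \<in> carrier A"
    using assms by (intro A_carrierI[of "W (S u) (S v)"] finite_W P_closed P_zero)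
      (auto simp: A_fin S_sub)
  then show ?thesis by (simp add: basis_algebra_def P_def)
qed

lemma S_mult:
  assumes "u \<in> carrier A" "v \<in> carrier A" shows "S (u \<otimes>\<^bsub>A\<^esub> v) \<subseteq> W (S u) (S v)"
proof
  fix c assume "c \<in> S (u \<otimes>\<^bsub>A\<^esub> v)"
  then have "c \<in> B" "(u \<otimes>\<^bsub>A\<^esub> v) c \<noteq> \<zero>"
    unfolding coeff_supp_def by blast+
  then show "c \<in> W (S u) (S v)"
    using A_mult' P_zero by metis
qed

lemma P_add_left:
  assumes "u \<in> carrier A" "u' \<in> carrier A" "v \<in> carrier A" "T \<subseteq> B" "T' \<subseteq> B"
  shows "P T T' (u \<oplus>\<^bsub>A\<^esub> u') v c = P T T' u v c \<oplus> P T T' u' v c"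
proof -
  have "P T T' (u \<oplus>\<^bsub>A\<^esub> u') v c = (\<Oplus>a\<in>T.
      (\<Oplus>b\<in>T'. if m a b = Some c then u a \<otimes> v b else \<zero>) \<oplus> (\<Oplus>b\<in>T'. if m a b = Some c then u' a \<otimes> v b else \<zero>))"
    unfolding P_def
  proof (rule finsum_cong'[OF refl])
    fix a assume "a \<in> T"
    show "(\<Oplus>b\<in>T'. if m a b = Some c then (u \<oplus>\<^bsub>A\<^esub> u') a \<otimes> v b else \<zero>) =
      (\<Oplus>b\<in>T'. if m a b = Some c then u a \<otimes> v b else \<zero>) \<oplus> (\<Oplus>b\<in>T'. if m a b = Some c then u' a \<otimes> v b else \<zero>)"
      (is "?L = _")
    proof -
      have "?L = (\<Oplus>b\<in>T'. (if m a b = Some c then u a \<otimes> v b else \<zero>) \<oplus> (if m a b = Some c then u' a \<otimes> v b else \<zero>))"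
        using assms \<open>a \<in> T\<close> by (intro finsum_cong'[OF refl]) (auto simp: A_add A_coeff l_distr subset_iff)
      then show ?thesis
        using assms \<open>a \<in> T\<close> by (subst (asm) finsum_addf) (auto simp: A_coeff subset_iff)
    qed
  qed (use assms in \<open>auto intro!: finsum_closed a_closed simp: A_coeff subset_iff\<close>)
  also have "\<dots> = P T T' u v c \<oplus> P T T' u' v c"
    unfolding P_def using assms
    by (intro finsum_addf) (auto intro!: finsum_closed simp: A_coeff subset_iff)
  finally show ?thesis .
qed

lemma P_add_right:
  assumes "u \<in> carrier A" "v \<in> carrier A" "v' \<in> carrier A" "T \<subseteq> B" "T' \<subseteq> B"
  shows "P T T' u (v \<oplus>\<^bsub>A\<^esub> v') c = P T T' u v c \<oplus> P T T' u v' c"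
proof -
  have "P T T' u (v \<oplus>\<^bsub>A\<^esub> v') c = (\<Oplus>a\<in>T.
      (\<Oplus>b\<in>T'. if m a b = Some c then u a \<otimes> v b else \<zero>) \<oplus> (\<Oplus>b\<in>T'. if m a b = Some c then u a \<otimes> v' b else \<zero>))"
    unfolding P_def
  proof (rule finsum_cong'[OF refl])
    fix a assume "a \<in> T"
    show "(\<Oplus>b\<in>T'. if m a b = Some c then u a \<otimes> (v \<oplus>\<^bsub>A\<^esub> v') b else \<zero>) =
      (\<Oplus>b\<in>T'. if m a b = Some c then u a \<otimes> v b else \<zero>) \<oplus> (\<Oplus>b\<in>T'. if m a b = Some c then u a \<otimes> v' b else \<zero>)"
      (is "?L = _")
    proof -
      have "?L = (\<Oplus>b\<in>T'. (if m a b = Some c then u a \<otimes> v b else \<zero>) \<oplus> (if m a b = Some c then u a \<otimes> v' b else \<zero>))"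
        using assms \<open>a \<in> T\<close> by (intro finsum_cong'[OF refl]) (auto simp: A_add A_coeff r_distr subset_iff)
      then show ?thesis
        using assms \<open>a \<in> T\<close> by (subst (asm) finsum_addf) (auto simp: A_coeff subset_iff)
    qed
  qed (use assms in \<open>auto intro!: finsum_closed a_closed simp: A_coeff subset_iff\<close>)
  also have "\<dots> = P T T' u v c \<oplus> P T T' u v' c"
    unfolding P_def using assms
    by (intro finsum_addf) (auto intro!: finsum_closed simp: A_coeff subset_iff)
  finally show ?thesis .
qed

lemma P_smult:
  assumes "r \<in> carrier R" "u \<in> carrier A" "v \<in> carrier A" "T \<subseteq> B" "T' \<subseteq> B" "finite T" "finite T'"
  shows "P T T' (r \<odot>\<^bsub>A\<^esub> u) v c = r \<otimes> P T T' u v c"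
    and "P T T' u (r \<odot>\<^bsub>A\<^esub> v) c = r \<otimes> P T T' u v c"
proof -
  have *: "r \<otimes> P T T' u v c = (\<Oplus>a\<in>T. \<Oplus>b\<in>T'. r \<otimes> (if m a b = Some c then u a \<otimes> v b else \<zero>))"
  proof -
    have "r \<otimes> P T T' u v c = (\<Oplus>a\<in>T. r \<otimes> (\<Oplus>b\<in>T'. if m a b = Some c then u a \<otimes> v b else \<zero>))"
      unfolding P_def using assms
      by (intro finsum_rdistr) (auto intro!: finsum_closed simp: A_coeff subset_iff)
    also have "\<dots> = (\<Oplus>a\<in>T. \<Oplus>b\<in>T'. r \<otimes> (if m a b = Some c then u a \<otimes> v b else \<zero>))"
    proof (rule finsum_cong'[OF refl])
      fix a assume "a \<in> T"
      then show "r \<otimes> (\<Oplus>b\<in>T'. if m a b = Some c then u a \<otimes> v b else \<zero>)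
        = (\<Oplus>b\<in>T'. r \<otimes> (if m a b = Some c then u a \<otimes> v b else \<zero>))"
        using assms by (intro finsum_rdistr) (auto simp: A_coeff subset_iff)
    qed (use assms in \<open>auto intro!: finsum_closed simp: A_coeff subset_iff\<close>)
    finally show ?thesis .
  qed
  show "P T T' (r \<odot>\<^bsub>A\<^esub> u) v c = r \<otimes> P T T' u v c"
    unfolding * unfolding P_def using assms
    by (intro finsum_cong') (auto intro!: finsum_closed finsum_cong' simp: A_smult A_coeff subset_iff m_assoc)
  show "P T T' u (r \<odot>\<^bsub>A\<^esub> v) c = r \<otimes> P T T' u v c"
    unfolding * unfolding P_def using assms
    by (intro finsum_cong') (auto intro!: finsum_closed finsum_cong' simp: A_smult A_coeff subset_iff m_lcomm)
qed

lemma l_distr_A: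
  assumes "u \<in> carrier A" "u' \<in> carrier A" "v \<in> carrier A"
  shows "(u \<oplus>\<^bsub>A\<^esub> u') \<otimes>\<^bsub>A\<^esub> v = u \<otimes>\<^bsub>A\<^esub> v \<oplus>\<^bsub>A\<^esub> u' \<otimes>\<^bsub>A\<^esub> v"
proof (rule A_eqI)
  fix c assume c: "c \<in> B"
  let ?T = "S u \<union> S u' \<union> S (u \<oplus>\<^bsub>A\<^esub> u')"
  have T: "finite ?T" "?T \<subseteq> B" using assms by (auto simp: A_fin add_closed_A dest: subsetD[OF S_sub])
  have V: "finite (S v)" "S v \<subseteq> B" using assms by (auto simp: A_fin dest: subsetD[OF S_sub])
  have eq: "(w \<otimes>\<^bsub>A\<^esub> v) c = P ?T (S v) w v c" if "w \<in> carrier A" "S w \<subseteq> ?T" for w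
    using that assms T V c by (intro A_mult) auto
  show "((u \<oplus>\<^bsub>A\<^esub> u') \<otimes>\<^bsub>A\<^esub> v) c = (u \<otimes>\<^bsub>A\<^esub> v \<oplus>\<^bsub>A\<^esub> u' \<otimes>\<^bsub>A\<^esub> v) c"
    using assms T V eq[of u] eq[of u'] eq[of "u \<oplus>\<^bsub>A\<^esub> u'"] c
    by (simp add: A_add P_add_left add_closed_A le_supI1 le_supI2)
qed (intro add_closed_A mult_closed_A assms)+

lemma r_distr_A:
  assumes "u \<in> carrier A" "u' \<in> carrier A" "v \<in> carrier A"
  shows "v \<otimes>\<^bsub>A\<^esub> (u \<oplus>\<^bsub>A\<^esub> u') = v \<otimes>\<^bsub>A\<^esub> u \<oplus>\<^bsub>A\<^esub> v \<otimes>\<^bsub>A\<^esub> u'"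
proof (rule A_eqI)
  fix c assume c: "c \<in> B"
  let ?T = "S u \<union> S u' \<union> S (u \<oplus>\<^bsub>A\<^esub> u')"
  have T: "finite ?T" "?T \<subseteq> B" using assms by (auto simp: A_fin add_closed_A dest: subsetD[OF S_sub])
  have V: "finite (S v)" "S v \<subseteq> B" using assms by (auto simp: A_fin dest: subsetD[OF S_sub])
  have eq: "(v \<otimes>\<^bsub>A\<^esub> w) c = P (S v) ?T v w c" if "w \<in> carrier A" "S w \<subseteq> ?T" for w
    using that assms T V c by (intro A_mult) auto
  show "(v \<otimes>\<^bsub>A\<^esub> (u \<oplus>\<^bsub>A\<^esub> u')) c = (v \<otimes>\<^bsub>A\<^esub> u \<oplus>\<^bsub>A\<^esub> v \<otimes>\<^bsub>A\<^esub> u') c"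
    using assms T V eq[of u] eq[of u'] eq[of "u \<oplus>\<^bsub>A\<^esub> u'"] c
    by (simp add: A_add P_add_right add_closed_A le_supI1 le_supI2)
qed (intro add_closed_A mult_closed_A assms)+

lemma smult_A:
  assumes "r \<in> carrier R" "u \<in> carrier A" "v \<in> carrier A"
  shows "(r \<odot>\<^bsub>A\<^esub> u) \<otimes>\<^bsub>A\<^esub> v = r \<odot>\<^bsub>A\<^esub> (u \<otimes>\<^bsub>A\<^esub> v)"
    and "u \<otimes>\<^bsub>A\<^esub> (r \<odot>\<^bsub>A\<^esub> v) = r \<odot>\<^bsub>A\<^esub> (u \<otimes>\<^bsub>A\<^esub> v)"
proof -
  have S: "S (r \<odot>\<^bsub>A\<^esub> w) \<subseteq> S w" for w
    using assms(1) by (auto simp: coeff_supp_def A_smult)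
  show "(r \<odot>\<^bsub>A\<^esub> u) \<otimes>\<^bsub>A\<^esub> v = r \<odot>\<^bsub>A\<^esub> (u \<otimes>\<^bsub>A\<^esub> v)"
    using assms S[of u] A_mult[of "r \<odot>\<^bsub>A\<^esub> u" v "S u" "S v"]
    by (intro A_eqI) (auto intro: smult_closed_A mult_closed_A simp: A_smult A_mult' P_smult A_fin S_sub smult_closed_A)
  show "u \<otimes>\<^bsub>A\<^esub> (r \<odot>\<^bsub>A\<^esub> v) = r \<odot>\<^bsub>A\<^esub> (u \<otimes>\<^bsub>A\<^esub> v)"
    using assms S[of v] A_mult[of u "r \<odot>\<^bsub>A\<^esub> v" "S u" "S v"]
    by (intro A_eqI) (auto intro: smult_closed_A mult_closed_A simp: A_smult A_mult' P_smult A_fin S_sub smult_closed_A)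
qed

lemma S_one: "S \<one>\<^bsub>A\<^esub> \<subseteq> E"
proof
  fix c assume "c \<in> S \<one>\<^bsub>A\<^esub>"
  then have "c \<in> B" "\<one>\<^bsub>A\<^esub> c \<noteq> \<zero>" unfolding coeff_supp_def by blast+
  then show "c \<in> E" using A_one by metis
qed

lemma one_left_A:
  assumes u: "u \<in> carrier A" shows "\<one>\<^bsub>A\<^esub> \<otimes>\<^bsub>A\<^esub> u = u"
proof (rule A_eqI)
  fix c assume c: "c \<in> B"
  have cl: "u b \<in> carrier R" if "b \<in> B" for b using u that by (rule A_coeff)
  have fin: "finite (S u)" using u by (rule A_fin)
  have "(\<one>\<^bsub>A\<^esub> \<otimes>\<^bsub>A\<^esub> u) c = P E (S u \<union> {c}) \<one>\<^bsub>A\<^esub> u c"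
    using u E c fin S_one by (intro A_mult one_closed_A) (auto dest: subsetD[OF S_sub])
  also have "\<dots> = (\<Oplus>a\<in>E. \<Oplus>b\<in>S u \<union> {c}. if m a b = Some c then u b else \<zero>)"
    unfolding P_def
  proof (rule finsum_cong'[OF refl])
    fix a assume a: "a \<in> E"
    show "(\<Oplus>b\<in>S u \<union> {c}. if m a b = Some c then \<one>\<^bsub>A\<^esub> a \<otimes> u b else \<zero>)
        = (\<Oplus>b\<in>S u \<union> {c}. if m a b = Some c then u b else \<zero>)"
      using a E c cl by (intro finsum_cong'[OF refl]) (auto simp: A_one coeff_supp_def subset_iff)
  qed (use c cl in \<open>auto intro!: finsum_closed simp: coeff_supp_def\<close>)
  also have "\<dots> = (\<Oplus>b\<in>S u \<union> {c}. \<Oplus>a\<in>E. if m a b = Some c then u b else \<zero>)"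
    using E c cl fin by (intro finsum_swap_double) (auto simp: coeff_supp_def)
  also have "\<dots> = (\<Oplus>b\<in>S u \<union> {c}. if c = b then u b else \<zero>)"
  proof (rule finsum_cong'[OF refl])
    fix b assume "b \<in> S u \<union> {c}"
    then have b: "b \<in> B" using c by (auto simp: coeff_supp_def)
    obtain x where x: "x \<in> E" "\<And>a. a \<in> E \<Longrightarrow> m a b = (if a = x then Some b else None)"
      using E_left[OF b] by blast
    have "(\<Oplus>a\<in>E. if m a b = Some c then u b else \<zero>)
        = (\<Oplus>a\<in>E. if x = a then (if c = b then u b else \<zero>) else \<zero>)"
      using x b cl by (intro finsum_cong') auto
    also have "\<dots> = (if c = b then u b else \<zero>)"
      using x E b cl by (intro finsum_singleton) auto
    finally show "(\<Oplus>a\<in>E. if m a b = Some c then u b else \<zero>) = (if c = b then u b else \<zero>)" .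
  qed (use c cl in \<open>auto simp: coeff_supp_def\<close>)
  also have "\<dots> = u c"
    using fin c cl by (intro finsum_singleton) (auto simp: coeff_supp_def)
  finally show "(\<one>\<^bsub>A\<^esub> \<otimes>\<^bsub>A\<^esub> u) c = u c" .
qed (intro mult_closed_A one_closed_A u)+

lemma one_right_A:
  assumes u: "u \<in> carrier A" shows "u \<otimes>\<^bsub>A\<^esub> \<one>\<^bsub>A\<^esub> = u"
proof (rule A_eqI)
  fix c assume c: "c \<in> B"
  have cl: "u b \<in> carrier R" if "b \<in> B" for b using u that by (rule A_coeff)
  have fin: "finite (S u)" using u by (rule A_fin)
  have "(u \<otimes>\<^bsub>A\<^esub> \<one>\<^bsub>A\<^esub>) c = P (S u \<union> {c}) E u \<one>\<^bsub>A\<^esub> c"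
    using u E c fin S_one by (intro A_mult one_closed_A) (auto dest: subsetD[OF S_sub])
  also have "\<dots> = (\<Oplus>b\<in>S u \<union> {c}. \<Oplus>a\<in>E. if m b a = Some c then u b else \<zero>)"
    unfolding P_def
  proof (rule finsum_cong'[OF refl])
    fix b assume b: "b \<in> S u \<union> {c}"
    then have "b \<in> B" using c by (auto simp: coeff_supp_def)
    then show "(\<Oplus>a\<in>E. if m b a = Some c then u b \<otimes> \<one>\<^bsub>A\<^esub> a else \<zero>)
        = (\<Oplus>a\<in>E. if m b a = Some c then u b else \<zero>)"
      using E cl by (intro finsum_cong'[OF refl]) (auto simp: A_one subset_iff)
  qed (use c cl in \<open>auto intro!: finsum_closed simp: coeff_supp_def\<close>)
  also have "\<dots> = (\<Oplus>b\<in>S u \<union> {c}. if c = b then u b else \<zero>)"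
  proof (rule finsum_cong'[OF refl])
    fix b assume "b \<in> S u \<union> {c}"
    then have b: "b \<in> B" using c by (auto simp: coeff_supp_def)
    obtain x where x: "x \<in> E" "\<And>a. a \<in> E \<Longrightarrow> m b a = (if a = x then Some b else None)"
      using E_right[OF b] by blast
    have "(\<Oplus>a\<in>E. if m b a = Some c then u b else \<zero>)
        = (\<Oplus>a\<in>E. if x = a then (if c = b then u b else \<zero>) else \<zero>)"
      using x b cl by (intro finsum_cong') auto
    also have "\<dots> = (if c = b then u b else \<zero>)"
      using x E b cl by (intro finsum_singleton) auto
    finally show "(\<Oplus>a\<in>E. if m b a = Some c then u b else \<zero>) = (if c = b then u b else \<zero>)" .
  qed (use c cl in \<open>auto simp: coeff_supp_def\<close>)
  also have "\<dots> = u c"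
    using fin c cl by (intro finsum_singleton) (auto simp: coeff_supp_def)
  finally show "(u \<otimes>\<^bsub>A\<^esub> \<one>\<^bsub>A\<^esub>) c = u c" .
qed (intro mult_closed_A one_closed_A u)+

lemma P_P_left:
  assumes u: "u \<in> carrier A" "v \<in> carrier A" "w \<in> carrier A"
  shows "P (W (S u) (S v)) (S w) (u \<otimes>\<^bsub>A\<^esub> v) w d =
    (\<Oplus>a\<in>S u. \<Oplus>b\<in>S v. \<Oplus>c\<in>S w.
       if Option.bind (m a b) (\<lambda>x. m x c) = Some d then u a \<otimes> v b \<otimes> w c else \<zero>)"
proof -
  let ?X = "W (S u) (S v)"
  have cu: "u a \<in> carrier R" if "a \<in> S u" for a using u that S_sub A_coeff by blast
  have cv: "v a \<in> carrier R" if "a \<in> S v" for a using u that S_sub A_coeff by blast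
  have cw: "w a \<in> carrier R" if "a \<in> S w" for a using u that S_sub A_coeff by blast
  have fin: "finite (S u)" "finite (S v)" "finite (S w)" "finite ?X"
    using u by (auto simp: A_fin finite_W)
  let ?f = "\<lambda>x c a b. if m a b = Some x then (if m x c = Some d then u a \<otimes> v b \<otimes> w c else \<zero>) else \<zero>"
  have f: "?f x c a b \<in> carrier R" if "a \<in> S u" "b \<in> S v" "c \<in> S w" for x c a b
    using that cu cv cw by auto
  have "P ?X (S w) (u \<otimes>\<^bsub>A\<^esub> v) w d = (\<Oplus>x\<in>?X. \<Oplus>c\<in>S w. \<Oplus>a\<in>S u. \<Oplus>b\<in>S v. ?f x c a b)"
    unfolding P_def
  proof (intro finsum_cong')
    fix x c assume x: "x \<in> ?X" and c: "c \<in> S w"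
    have xB: "x \<in> B" using x W_sub by blast
    show "(if m x c = Some d then (u \<otimes>\<^bsub>A\<^esub> v) x \<otimes> w c else \<zero>) = (\<Oplus>a\<in>S u. \<Oplus>b\<in>S v. ?f x c a b)"
    proof (cases "m x c = Some d")
      case True
      have "(u \<otimes>\<^bsub>A\<^esub> v) x \<otimes> w c = (\<Oplus>a\<in>S u. (\<Oplus>b\<in>S v. if m a b = Some x then u a \<otimes> v b else \<zero>) \<otimes> w c)"
        unfolding A_mult'[OF xB] P_def using fin cu cv cw c
        by (intro finsum_ldistr) (auto intro!: finsum_closed)
      also have "\<dots> = (\<Oplus>a\<in>S u. \<Oplus>b\<in>S v. ?f x c a b)"
      proof (rule finsum_cong'[OF refl])
        fix a assume a: "a \<in> S u"
        have "(\<Oplus>b\<in>S v. if m a b = Some x then u a \<otimes> v b else \<zero>) \<otimes> w c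
            = (\<Oplus>b\<in>S v. (if m a b = Some x then u a \<otimes> v b else \<zero>) \<otimes> w c)"
          using fin cu cv cw c a by (intro finsum_ldistr) auto
        also have "\<dots> = (\<Oplus>b\<in>S v. ?f x c a b)"
          using True f a c cw by (intro finsum_cong') auto
        finally show "(\<Oplus>b\<in>S v. if m a b = Some x then u a \<otimes> v b else \<zero>) \<otimes> w c = (\<Oplus>b\<in>S v. ?f x c a b)" .
      qed (use f c in \<open>auto intro!: finsum_closed\<close>)
      finally show ?thesis using True by simp
    next
      case False
      then have "(\<Oplus>a\<in>S u. \<Oplus>b\<in>S v. ?f x c a b) = (\<Oplus>a\<in>S u. \<Oplus>b\<in>S v. \<zero>)"
        by (intro finsum_cong') (auto intro!: finsum_cong')
      then show ?thesis using False by (simp add: finsum_zero)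
    qed
  qed (use f in \<open>auto intro!: finsum_closed\<close>)
  also have "\<dots> = (\<Oplus>c\<in>S w. \<Oplus>a\<in>S u. \<Oplus>b\<in>S v. \<Oplus>x\<in>?X. ?f x c a b)"
  proof -
    have "(\<Oplus>x\<in>?X. \<Oplus>c\<in>S w. \<Oplus>a\<in>S u. \<Oplus>b\<in>S v. ?f x c a b) = (\<Oplus>c\<in>S w. \<Oplus>x\<in>?X. \<Oplus>a\<in>S u. \<Oplus>b\<in>S v. ?f x c a b)"
      using fin f by (intro finsum_swap_double) (auto intro!: finsum_closed)
    also have "\<dots> = (\<Oplus>c\<in>S w. \<Oplus>a\<in>S u. \<Oplus>x\<in>?X. \<Oplus>b\<in>S v. ?f x c a b)"
      using fin f by (intro finsum_cong' finsum_swap_double) (auto intro!: finsum_closed)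
    also have "\<dots> = (\<Oplus>c\<in>S w. \<Oplus>a\<in>S u. \<Oplus>b\<in>S v. \<Oplus>x\<in>?X. ?f x c a b)"
      using fin f by (intro finsum_cong' finsum_swap_double) (auto intro!: finsum_closed)
    finally show ?thesis .
  qed
  also have "\<dots> = (\<Oplus>c\<in>S w. \<Oplus>a\<in>S u. \<Oplus>b\<in>S v.
      if Option.bind (m a b) (\<lambda>x. m x c) = Some d then u a \<otimes> v b \<otimes> w c else \<zero>)" (is "_ = (\<Oplus>c\<in>S w. \<Oplus>a\<in>S u. \<Oplus>b\<in>S v. ?g c a b)")
  proof -
    have g: "?g c a b \<in> carrier R" if "a \<in> S u" "b \<in> S v" "c \<in> S w" for c a b
      using that cu cv cw by auto
    have "(\<Oplus>x\<in>?X. ?f x c a b) = ?g c a b" if "a \<in> S u" "b \<in> S v" "c \<in> S w" for c a b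
    proof -
      have ab: "a \<in> B" "b \<in> B" using that S_sub by blast+
      have "(\<Oplus>x\<in>?X. ?f x c a b) = (case m a b of None \<Rightarrow> \<zero>
         | Some x \<Rightarrow> if m x c = Some d then u a \<otimes> v b \<otimes> w c else \<zero>)"
        using fin that cu cv cw m_closed_basis[OF ab]
        by (intro finsum_delta_option) (auto simp: W_def)
      also have "\<dots> = ?g c a b" by (cases "m a b") auto
      finally show ?thesis .
    qed
    then show ?thesis using g by (intro finsum_cong') (auto intro!: finsum_closed)
  qed
  also have "\<dots> = (\<Oplus>a\<in>S u. \<Oplus>c\<in>S w. \<Oplus>b\<in>S v.
      if Option.bind (m a b) (\<lambda>x. m x c) = Some d then u a \<otimes> v b \<otimes> w c else \<zero>)"
    using fin cu cv cw by (intro finsum_swap_double) (auto intro!: finsum_closed)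
  also have "\<dots> = (\<Oplus>a\<in>S u. \<Oplus>b\<in>S v. \<Oplus>c\<in>S w.
      if Option.bind (m a b) (\<lambda>x. m x c) = Some d then u a \<otimes> v b \<otimes> w c else \<zero>)"
    using fin cu cv cw by (intro finsum_cong' finsum_swap_double) (auto intro!: finsum_closed)
  finally show ?thesis .
qed

lemma P_P_right:
  assumes u: "u \<in> carrier A" "v \<in> carrier A" "w \<in> carrier A"
  shows "P (S u) (W (S v) (S w)) u (v \<otimes>\<^bsub>A\<^esub> w) d =
    (\<Oplus>a\<in>S u. \<Oplus>b\<in>S v. \<Oplus>c\<in>S w.
       if Option.bind (m b c) (\<lambda>y. m a y) = Some d then u a \<otimes> v b \<otimes> w c else \<zero>)"
  unfolding P_def
proof (rule finsum_cong'[OF refl])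
  let ?X = "W (S v) (S w)"
  have cu: "u a \<in> carrier R" if "a \<in> S u" for a using u that S_sub A_coeff by blast
  have cv: "v a \<in> carrier R" if "a \<in> S v" for a using u that S_sub A_coeff by blast
  have cw: "w a \<in> carrier R" if "a \<in> S w" for a using u that S_sub A_coeff by blast
  have fin: "finite (S u)" "finite (S v)" "finite (S w)" "finite ?X"
    using u by (auto simp: A_fin finite_W)
  let ?f = "\<lambda>a x b c. if m b c = Some x then (if m a x = Some d then u a \<otimes> v b \<otimes> w c else \<zero>) else \<zero>"
  let ?g = "\<lambda>a b c. if Option.bind (m b c) (\<lambda>y. m a y) = Some d then u a \<otimes> v b \<otimes> w c else \<zero>"
  have f: "?f a x b c \<in> carrier R" if "a \<in> S u" "b \<in> S v" "c \<in> S w" for x c a b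
    using that cu cv cw by auto
  have g: "?g a b c \<in> carrier R" if "a \<in> S u" "b \<in> S v" "c \<in> S w" for c a b
    using that cu cv cw by auto
  show "(\<lambda>a. \<Oplus>b\<in>S v. \<Oplus>c\<in>S w. ?g a b c) \<in> S u \<rightarrow> carrier R"
    using g by (auto intro!: finsum_closed)
  fix a assume a: "a \<in> S u"
  have "(\<Oplus>x\<in>?X. if m a x = Some d then u a \<otimes> (v \<otimes>\<^bsub>A\<^esub> w) x else \<zero>)
      = (\<Oplus>x\<in>?X. \<Oplus>b\<in>S v. \<Oplus>c\<in>S w. ?f a x b c)"
  proof (rule finsum_cong'[OF refl])
    fix x assume x: "x \<in> ?X"
    have xB: "x \<in> B" using x W_sub by blast
    show "(if m a x = Some d then u a \<otimes> (v \<otimes>\<^bsub>A\<^esub> w) x else \<zero>) = (\<Oplus>b\<in>S v. \<Oplus>c\<in>S w. ?f a x b c)"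
    proof (cases "m a x = Some d")
      case True
      have "u a \<otimes> (v \<otimes>\<^bsub>A\<^esub> w) x = (\<Oplus>b\<in>S v. u a \<otimes> (\<Oplus>c\<in>S w. if m b c = Some x then v b \<otimes> w c else \<zero>))"
        unfolding A_mult'[OF xB] P_def using fin cu cv cw a
        by (intro finsum_rdistr) (auto intro!: finsum_closed)
      also have "\<dots> = (\<Oplus>b\<in>S v. \<Oplus>c\<in>S w. ?f a x b c)"
      proof (rule finsum_cong'[OF refl])
        fix b assume b: "b \<in> S v"
        have "u a \<otimes> (\<Oplus>c\<in>S w. if m b c = Some x then v b \<otimes> w c else \<zero>)
            = (\<Oplus>c\<in>S w. u a \<otimes> (if m b c = Some x then v b \<otimes> w c else \<zero>))"
          using fin cu cv cw b a by (intro finsum_rdistr) auto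
        also have "\<dots> = (\<Oplus>c\<in>S w. ?f a x b c)"
          using True f a b cu cv cw by (intro finsum_cong') (auto simp: m_assoc)
        finally show "u a \<otimes> (\<Oplus>c\<in>S w. if m b c = Some x then v b \<otimes> w c else \<zero>) = (\<Oplus>c\<in>S w. ?f a x b c)" .
      qed (use f a in \<open>auto intro!: finsum_closed\<close>)
      finally show ?thesis using True by simp
    next
      case False
      then have "(\<Oplus>b\<in>S v. \<Oplus>c\<in>S w. ?f a x b c) = (\<Oplus>b\<in>S v. \<Oplus>c\<in>S w. \<zero>)"
        by (intro finsum_cong') (auto intro!: finsum_cong')
      then show ?thesis using False by (simp add: finsum_zero)
    qed
  qed (use f a in \<open>auto intro!: finsum_closed\<close>)
  also have "\<dots> = (\<Oplus>b\<in>S v. \<Oplus>x\<in>?X. \<Oplus>c\<in>S w. ?f a x b c)"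
    using fin f a by (intro finsum_swap_double) (auto intro!: finsum_closed)
  also have "\<dots> = (\<Oplus>b\<in>S v. \<Oplus>c\<in>S w. \<Oplus>x\<in>?X. ?f a x b c)"
    using fin f a by (intro finsum_cong' finsum_swap_double) (auto intro!: finsum_closed)
  also have "\<dots> = (\<Oplus>b\<in>S v. \<Oplus>c\<in>S w. ?g a b c)"
  proof -
    have "(\<Oplus>x\<in>?X. ?f a x b c) = ?g a b c" if "b \<in> S v" "c \<in> S w" for c b
    proof -
      have bc: "b \<in> B" "c \<in> B" using that S_sub by blast+
      have "(\<Oplus>x\<in>?X. ?f a x b c) = (case m b c of None \<Rightarrow> \<zero>
         | Some x \<Rightarrow> if m a x = Some d then u a \<otimes> v b \<otimes> w c else \<zero>)"
        using fin that a cu cv cw m_closed_basis[OF bc]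
        by (intro finsum_delta_option) (auto simp: W_def)
      also have "\<dots> = ?g a b c" by (cases "m b c") auto
      finally show ?thesis .
    qed
    then show ?thesis using g a by (intro finsum_cong') (auto intro!: finsum_closed)
  qed
  finally show "(\<Oplus>x\<in>?X. if m a x = Some d then u a \<otimes> (v \<otimes>\<^bsub>A\<^esub> w) x else \<zero>)
      = (\<Oplus>b\<in>S v. \<Oplus>c\<in>S w. ?g a b c)" .
qed

lemma mult_assoc_A:
  assumes u: "u \<in> carrier A" "v \<in> carrier A" "w \<in> carrier A"
  shows "u \<otimes>\<^bsub>A\<^esub> v \<otimes>\<^bsub>A\<^esub> w = u \<otimes>\<^bsub>A\<^esub> (v \<otimes>\<^bsub>A\<^esub> w)"
proof (rule A_eqI)
  fix d assume d: "d \<in> B"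
  have cu: "u a \<in> carrier R" if "a \<in> S u" for a using u that S_sub A_coeff by blast
  have cv: "v a \<in> carrier R" if "a \<in> S v" for a using u that S_sub A_coeff by blast
  have cw: "w a \<in> carrier R" if "a \<in> S w" for a using u that S_sub A_coeff by blast
  have "(u \<otimes>\<^bsub>A\<^esub> v \<otimes>\<^bsub>A\<^esub> w) d = P (W (S u) (S v)) (S w) (u \<otimes>\<^bsub>A\<^esub> v) w d"
    using u d by (intro A_mult mult_closed_A S_mult W_sub finite_W A_fin S_sub order_refl)
  also have "\<dots> = P (S u) (W (S v) (S w)) u (v \<otimes>\<^bsub>A\<^esub> w) d"
  proof -
    have "Option.bind (m a b) (\<lambda>x. m x c) = Option.bind (m b c) (\<lambda>y. m a y)"
      if "a \<in> S u" "b \<in> S v" "c \<in> S w" for a b c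
      using that S_sub by (intro m_assoc_basis) blast+
    then show ?thesis
      unfolding P_P_left[OF u] P_P_right[OF u] using cu cv cw
      by (intro finsum_cong' refl) (auto intro!: finsum_closed)
  qed
  also have "\<dots> = (u \<otimes>\<^bsub>A\<^esub> (v \<otimes>\<^bsub>A\<^esub> w)) d"
    using u d by (intro A_mult[symmetric] mult_closed_A S_mult W_sub finite_W A_fin S_sub order_refl)
  finally show "(u \<otimes>\<^bsub>A\<^esub> v \<otimes>\<^bsub>A\<^esub> w) d = (u \<otimes>\<^bsub>A\<^esub> (v \<otimes>\<^bsub>A\<^esub> w)) d" .
qed (intro mult_closed_A u)+

lemma monoid_A: "monoid A"
  using mult_closed_A one_closed_A mult_assoc_A one_left_A one_right_A by (rule monoidI)

lemma ring_A: "ring A"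
  using abelian_group_A monoid_A l_distr_A r_distr_A by (rule ringI)

lemma assoc_algebra_A: "assoc_algebra R A"
  using module_A ring_A assoc_algebra_axioms.intro[OF smult_A] by (rule assoc_algebra.intro)

end

lemma monoid_algebra_assoc_algebra:
  assumes R: "cring R" and M: "monoid M"
  shows "assoc_algebra R (monoid_algebra R M)"
proof -
  have "basis_algebra_setup R (carrier M) (\<lambda>a b. Some (a \<otimes>\<^bsub>M\<^esub> b)) {\<one>\<^bsub>M\<^esub>}"
    by (intro basis_algebra_setup.intro R basis_algebra_setup_axioms.intro)
      (auto simp: monoid.m_closed[OF M] monoid.m_assoc[OF M] monoid.one_closed[OF M]
        monoid.l_one[OF M] monoid.r_one[OF M])
  from basis_algebra_setup.assoc_algebra_A[OF this] show ?thesis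
    by (simp add: monoid_algebra_def basis_vec_def)
qed

lemma incidence_algebra_assoc_algebra:
  assumes R: "cring R" and L: "partial_order L" and fin: "finite (carrier L)"
  shows "assoc_algebra R (incidence_algebra R L)"
proof -
  interpret L: partial_order L by (rule L)
  let ?m = "\<lambda>(U, V) (X, Y). if Y = U then Some (X, V) else None"
  let ?E = "(\<lambda>X. (X, X)) ` carrier L"
  have "basis_algebra_setup R (incidence_pairs L) ?m ?E"
  proof (intro basis_algebra_setup.intro R basis_algebra_setup_axioms.intro)
    show "Option.bind (?m a b) (\<lambda>x. ?m x c) = Option.bind (?m b c) (?m a)" for a b c
      by (cases a; cases b; cases c) auto
    show "c \<in> incidence_pairs L"
      if "a \<in> incidence_pairs L" "b \<in> incidence_pairs L" "?m a b = Some c" for a b c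
      using that by (auto simp: incidence_pairs_def split: if_splits intro: L.le_trans)
    show "finite ?E" using fin by simp
    show "?E \<subseteq> incidence_pairs L" by (auto simp: incidence_pairs_def)
    fix b assume "b \<in> incidence_pairs L"
    then obtain X Y where b: "b = (X, Y)" "X \<in> carrier L" "Y \<in> carrier L"
      by (auto simp: incidence_pairs_def)
    show "\<exists>x\<in>?E. \<forall>a\<in>?E. ?m a b = (if a = x then Some b else None)"
      using b by (intro bexI[of _ "(Y, Y)"]) auto
    show "\<exists>x\<in>?E. \<forall>a\<in>?E. ?m b a = (if a = x then Some b else None)"
      using b by (intro bexI[of _ "(X, X)"]) auto
  qed
  from basis_algebra_setup.assoc_algebra_A[OF this]
  have "assoc_algebra R (basis_algebra R (incidence_pairs L) ?m
          (\<lambda>c\<in>incidence_pairs L. if c \<in> ?E then \<one>\<^bsub>R\<^esub> else \<zero>\<^bsub>R\<^esub>))" .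
  moreover have "(\<lambda>c\<in>incidence_pairs L. if c \<in> ?E then \<one>\<^bsub>R\<^esub> else \<zero>\<^bsub>R\<^esub>)
      = (\<lambda>(X, Y)\<in>incidence_pairs L. if X = Y then \<one>\<^bsub>R\<^esub> else \<zero>\<^bsub>R\<^esub>)"
    by (rule restrict_ext) (auto simp: incidence_pairs_def)
  ultimately show ?thesis
    by (simp only: incidence_algebra_def)
qed

end

theory Submission
  imports Defs
begin

text \<open>
  \<open>\<phi>\<close> respects products because \<open>S\<close> is a partial cross-section for \<open>f \<circ> g\<close> iff it is one for
  \<open>g\<close> and \<open>g ` S\<close> is one for \<open>f\<close>; here one uses that \<open>f\<close> fixes \<open>n + 1\<close>.
  For bijectivity, let \<open>D f\<close> be the set of \<open>i \<le> n\<close> with \<open>f i < f (i + 1)\<close>, that is, the maxima of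
  the fibres of \<open>f\<close> over \<open>{1..n}\<close>. Then \<open>f \<mapsto> (D f, f ` D f)\<close> is a bijection from the Catalan
  monoid onto the basis of the incidence algebra, and any \<open>g\<close> mapping \<open>D f\<close> injectively onto
  \<open>f ` D f\<close> is pointwise at most \<open>f\<close>. So the matrix of \<open>\<phi>\<close> is unitriangular with respect to
  the pointwise order, hence invertible over any commutative ring.
\<close>

section \<open>Linear maps with a 0-1 matrix\<close>

text \<open>The relation is the support of the matrix: \<open>\<rho> p q\<close> puts the entry 1 in
  column \<open>p\<close> and row \<open>q\<close>. The sum runs over all of \<open>B\<close> and
  not over a support, so \<open>B\<close> is meant to be finite.\<close>

definition rel_map ::
  "('r, 's) ring_scheme \<Rightarrow> 'b set \<Rightarrow> 'c set \<Rightarrow> ('b \<Rightarrow> 'c \<Rightarrow> bool) \<Rightarrow> ('b \<Rightarrow> 'r) \<Rightarrow> ('c \<Rightarrow> 'r)"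
where
  "rel_map R B B' \<rho> u = (\<lambda>q\<in>B'. \<Oplus>\<^bsub>R\<^esub>p\<in>B. if \<rho> p q then u p else \<zero>\<^bsub>R\<^esub>)"

context cring
begin

section \<open>Coordinates in an algebra with a finite basis\<close>

lemma basis_algebra_carrier:
  "finite B \<Longrightarrow> carrier (basis_algebra R B m e) = B \<rightarrow>\<^sub>E carrier R"
  by (auto simp: basis_algebra_def coeff_supp_def)

text \<open>Terms outside the supports have a zero factor. Index sets that do not depend on
  \<open>u\<close> and \<open>v\<close> make the interchanges of sums in \<open>rel_map_mult\<close>
  possible.\<close>

lemma basis_algebra_mult:
  assumes B: "finite B" and u: "u \<in> B \<rightarrow>\<^sub>E carrier R" and v: "v \<in> B \<rightarrow>\<^sub>E carrier R" and c: "c \<in> B"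
  shows "(u \<otimes>\<^bsub>basis_algebra R B m e\<^esub> v) c
    = (\<Oplus>a\<in>B. \<Oplus>b\<in>B. if m a b = Some c then u a \<otimes> v b else \<zero>)"
proof -
  have cu: "u a \<in> carrier R" "v a \<in> carrier R" if "a \<in> B" for a
    using u v that by auto
  have "(u \<otimes>\<^bsub>basis_algebra R B m e\<^esub> v) c
    = (\<Oplus>a\<in>coeff_supp R B u. \<Oplus>b\<in>coeff_supp R B v. if m a b = Some c then u a \<otimes> v b else \<zero>)"
    using c by (simp add: basis_algebra_def)
  also have "\<dots> = (\<Oplus>a\<in>coeff_supp R B u. \<Oplus>b\<in>B. if m a b = Some c then u a \<otimes> v b else \<zero>)"
    using B cu
    by (intro finsum_cong' refl add.finprod_mono_neutral_cong_left)
      (auto simp: coeff_supp_def intro!: finsum_closed)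
  also have "\<dots> = (\<Oplus>a\<in>B. \<Oplus>b\<in>B. if m a b = Some c then u a \<otimes> v b else \<zero>)"
    using B cu
    by (intro add.finprod_mono_neutral_cong_left)
      (auto simp: coeff_supp_def intro!: finsum_closed add.finprod_one_eqI)
  finally show ?thesis .
qed

text \<open>Evaluation at a basis element is additive. This reads off the coefficients of the sum
  over \<open>PCS n f\<close>, which is formed in the incidence algebra.\<close>

lemma basis_algebra_finsum:
  assumes "finite B" "abelian_monoid (basis_algebra R B m e)"
    and "finite I" "\<And>i. i \<in> I \<Longrightarrow> x i \<in> B \<rightarrow>\<^sub>E carrier R" and c: "c \<in> B"
  shows "(\<Oplus>\<^bsub>basis_algebra R B m e\<^esub>i\<in>I. x i) c = (\<Oplus>i\<in>I. x i c)"
proof -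
  interpret A: abelian_monoid "basis_algebra R B m e" by fact
  show ?thesis using assms(3,4)
  proof (induction I)
    case empty
    have "\<zero>\<^bsub>basis_algebra R B m e\<^esub> c = \<zero>" using c by (simp add: basis_algebra_def)
    then show ?case by simp
  next
    case (insert i I)
    have xi: "x j \<in> carrier (basis_algebra R B m e)" if "j \<in> insert i I" for j
      using insert.prems that by (simp add: basis_algebra_carrier[OF assms(1)])
    have xc: "x j c \<in> carrier R" if "j \<in> insert i I" for j
      using insert.prems[OF that] c by auto
    have "(\<Oplus>\<^bsub>basis_algebra R B m e\<^esub>j\<in>insert i I. x j)
        = x i \<oplus>\<^bsub>basis_algebra R B m e\<^esub> (\<Oplus>\<^bsub>basis_algebra R B m e\<^esub>j\<in>I. x j)"
      using insert.hyps xi by (intro A.finsum_insert) auto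
    then have "(\<Oplus>\<^bsub>basis_algebra R B m e\<^esub>j\<in>insert i I. x j) c
        = x i c \<oplus> (\<Oplus>\<^bsub>basis_algebra R B m e\<^esub>j\<in>I. x j) c"
      using c by (simp add: basis_algebra_def)
    also have "\<dots> = (\<Oplus>j\<in>insert i I. x j c)"
      using insert xc by (subst finsum_insert) auto
    finally show ?case .
  qed
qed

section \<open>Sums of indicator terms\<close>

text \<open>As \<open>K\<close> holds at most once, several copies of \<open>x\<close> never add up,
  so existence replaces counting in every characteristic.\<close>

lemma finsum_delta:
  assumes "finite A" "x \<in> carrier R" "\<And>a b. a \<in> A \<Longrightarrow> b \<in> A \<Longrightarrow> K a \<Longrightarrow> K b \<Longrightarrow> a = b"
  shows "(\<Oplus>a\<in>A. if K a then x else \<zero>) = (if \<exists>a\<in>A. K a then x else \<zero>)"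
proof (cases "\<exists>a\<in>A. K a")
  case True
  then obtain a where a: "a \<in> A" "K a" by blast
  have "(\<Oplus>b\<in>A. if K b then x else \<zero>) = (\<Oplus>b\<in>A. if a = b then x else \<zero>)"
    using a assms(2,3) by (intro finsum_cong') auto
  also have "\<dots> = x" using a assms(1,2) by (intro finsum_singleton) auto
  finally show ?thesis using True by simp
next
  case False
  then show ?thesis by (auto intro!: add.finprod_one_eqI)
qed

lemma finsum_delta2:
  assumes "finite A" "finite B" "x \<in> carrier R"
    and "\<And>a b a' b'. \<lbrakk>a \<in> A; b \<in> B; a' \<in> A; b' \<in> B; K a b; K a' b'\<rbrakk> \<Longrightarrow> a = a' \<and> b = b'"
  shows "(\<Oplus>a\<in>A. \<Oplus>b\<in>B. if K a b then x else \<zero>) = (if \<exists>a\<in>A. \<exists>b\<in>B. K a b then x else \<zero>)"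
proof -
  have "(\<Oplus>a\<in>A. \<Oplus>b\<in>B. if K a b then x else \<zero>) = (\<Oplus>a\<in>A. if \<exists>b\<in>B. K a b then x else \<zero>)"
    using assms by (intro finsum_cong' finsum_delta) auto
  also have "\<dots> = (if \<exists>a\<in>A. \<exists>b\<in>B. K a b then x else \<zero>)"
    using assms by (intro finsum_delta) auto
  finally show ?thesis .
qed

lemma finsum_swap_pairs:
  assumes fin: "finite A" "finite B" "finite C" "finite D"
    and f: "\<And>a b c d. \<lbrakk>a \<in> A; b \<in> B; c \<in> C; d \<in> D\<rbrakk> \<Longrightarrow> f a b c d \<in> carrier R"
  shows "(\<Oplus>a\<in>A. \<Oplus>b\<in>B. \<Oplus>c\<in>C. \<Oplus>d\<in>D. f a b c d) = (\<Oplus>c\<in>C. \<Oplus>d\<in>D. \<Oplus>a\<in>A. \<Oplus>b\<in>B. f a b c d)"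
proof -
  have "(\<Oplus>a\<in>A. \<Oplus>b\<in>B. \<Oplus>c\<in>C. \<Oplus>d\<in>D. f a b c d) = (\<Oplus>a\<in>A. \<Oplus>c\<in>C. \<Oplus>b\<in>B. \<Oplus>d\<in>D. f a b c d)"
    using fin f by (intro finsum_cong' finsum_swap_double) (auto intro!: finsum_closed)
  also have "\<dots> = (\<Oplus>c\<in>C. \<Oplus>a\<in>A. \<Oplus>b\<in>B. \<Oplus>d\<in>D. f a b c d)"
    using fin f by (intro finsum_swap_double) (auto intro!: finsum_closed)
  also have "\<dots> = (\<Oplus>c\<in>C. \<Oplus>a\<in>A. \<Oplus>d\<in>D. \<Oplus>b\<in>B. f a b c d)"
    using fin f by (intro finsum_cong' finsum_swap_double) (auto intro!: finsum_closed)
  also have "\<dots> = (\<Oplus>c\<in>C. \<Oplus>d\<in>D. \<Oplus>a\<in>A. \<Oplus>b\<in>B. f a b c d)"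
    using fin f by (intro finsum_cong' finsum_swap_double) (auto intro!: finsum_closed)
  finally show ?thesis .
qed

section \<open>Linearity and multiplicativity of maps with a 0-1 matrix\<close>

lemma rel_map_coeff:
  "q \<in> B' \<Longrightarrow> rel_map R B B' \<rho> u q = (\<Oplus>p\<in>B. if \<rho> p q then u p else \<zero>)"
  by (simp add: rel_map_def)

lemma rel_map_closed:
  "u \<in> B \<rightarrow>\<^sub>E carrier R \<Longrightarrow> rel_map R B B' \<rho> u \<in> B' \<rightarrow>\<^sub>E carrier R"
  by (auto simp: rel_map_def intro!: finsum_closed)

lemma basis_vec_closed: "basis_vec R B b \<in> B \<rightarrow>\<^sub>E carrier R"
  by (auto simp: basis_vec_def)

lemma rel_map_basis_vec:
  assumes "finite B" "b \<in> B" "q \<in> B'"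
  shows "rel_map R B B' \<rho> (basis_vec R B b) q = (if \<rho> b q then \<one> else \<zero>)"
proof -
  have "rel_map R B B' \<rho> (basis_vec R B b) q = (\<Oplus>p\<in>B. if p = b \<and> \<rho> p q then \<one> else \<zero>)"
    using assms by (auto simp: rel_map_coeff basis_vec_def intro!: finsum_cong')
  also have "\<dots> = (if \<rho> b q then \<one> else \<zero>)"
    using assms by (subst finsum_delta) auto
  finally show ?thesis .
qed

lemma rel_map_add:
  assumes "finite B" "finite B'" "u \<in> B \<rightarrow>\<^sub>E carrier R" "v \<in> B \<rightarrow>\<^sub>E carrier R"
  shows "rel_map R B B' \<rho> (u \<oplus>\<^bsub>basis_algebra R B m e\<^esub> v)
    = rel_map R B B' \<rho> u \<oplus>\<^bsub>basis_algebra R B' m' e'\<^esub> rel_map R B B' \<rho> v"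
proof -
  have cu: "u a \<in> carrier R" "v a \<in> carrier R" if "a \<in> B" for a
    using assms that by auto
  have "(\<Oplus>p\<in>B. if \<rho> p q then (\<lambda>b\<in>B. u b \<oplus> v b) p else \<zero>)
      = (\<Oplus>p\<in>B. if \<rho> p q then u p else \<zero>) \<oplus> (\<Oplus>p\<in>B. if \<rho> p q then v p else \<zero>)" for q
  proof -
    have "(\<Oplus>p\<in>B. if \<rho> p q then (\<lambda>b\<in>B. u b \<oplus> v b) p else \<zero>)
        = (\<Oplus>p\<in>B. (if \<rho> p q then u p else \<zero>) \<oplus> (if \<rho> p q then v p else \<zero>))"
      using cu by (intro finsum_cong') auto
    also have "\<dots> = (\<Oplus>p\<in>B. if \<rho> p q then u p else \<zero>) \<oplus> (\<Oplus>p\<in>B. if \<rho> p q then v p else \<zero>)"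
      using cu by (intro finsum_addf) auto
    finally show ?thesis .
  qed
  then show ?thesis
    by (auto simp: basis_algebra_def rel_map_def)
qed

lemma rel_map_smult:
  assumes "finite B" "u \<in> B \<rightarrow>\<^sub>E carrier R" "r \<in> carrier R"
  shows "rel_map R B B' \<rho> (r \<odot>\<^bsub>basis_algebra R B m e\<^esub> u)
    = r \<odot>\<^bsub>basis_algebra R B' m' e'\<^esub> rel_map R B B' \<rho> u"
proof -
  have cu: "u a \<in> carrier R" if "a \<in> B" for a
    using assms that by auto
  have "(\<Oplus>p\<in>B. if \<rho> p q then (\<lambda>b\<in>B. r \<otimes> u b) p else \<zero>)
      = r \<otimes> (\<Oplus>p\<in>B. if \<rho> p q then u p else \<zero>)" for q
    using assms cu by (subst finsum_rdistr) (auto intro!: finsum_cong')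
  then show ?thesis
    by (auto simp: basis_algebra_def rel_map_def)
qed

text \<open>For basis elements \<open>a\<close> and \<open>b\<close>, the product of the images has
  at \<open>r\<close> the number of factorizations of \<open>r\<close> into \<open>p\<close> and
  \<open>q\<close> with \<open>\<rho> a p\<close> and \<open>\<rho> b q\<close>. By
  \<open>unique\<close> this number is 0 or 1, and by \<open>ex\<close> it is the coefficient at
  \<open>r\<close> of the image of the product. Interchanging sums extends this bilinearly.\<close>

lemma rel_map_mult:
  fixes m :: "'x \<Rightarrow> 'x \<Rightarrow> 'x option" and m' :: "'y \<Rightarrow> 'y \<Rightarrow> 'y option"
  assumes B: "finite B" "finite B'" and uv: "u \<in> B \<rightarrow>\<^sub>E carrier R" "v \<in> B \<rightarrow>\<^sub>E carrier R"
    and m_closed: "\<And>a b c. \<lbrakk>a \<in> B; b \<in> B; m a b = Some c\<rbrakk> \<Longrightarrow> c \<in> B"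
    and ex: "\<And>a b r. \<lbrakk>a \<in> B; b \<in> B; r \<in> B'\<rbrakk> \<Longrightarrow>
      (\<exists>c. m a b = Some c \<and> \<rho> c r) \<longleftrightarrow> (\<exists>p\<in>B'. \<exists>q\<in>B'. m' p q = Some r \<and> \<rho> a p \<and> \<rho> b q)"
    and unique: "\<And>a b r p q p' q'. \<lbrakk>a \<in> B; b \<in> B; r \<in> B'; p \<in> B'; q \<in> B'; p' \<in> B'; q' \<in> B';
      m' p q = Some r; \<rho> a p; \<rho> b q; m' p' q' = Some r; \<rho> a p'; \<rho> b q'\<rbrakk> \<Longrightarrow> p = p' \<and> q = q'"
  shows "rel_map R B B' \<rho> (u \<otimes>\<^bsub>basis_algebra R B m e\<^esub> v)
    = rel_map R B B' \<rho> u \<otimes>\<^bsub>basis_algebra R B' m' e'\<^esub> rel_map R B B' \<rho> v" (is "?L = ?M")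
proof
  fix r
  show "?L r = ?M r"
  proof (cases "r \<in> B'")
    case False
    then show ?thesis by (simp add: rel_map_def basis_algebra_def)
  next
    case r: True
    have cu: "u a \<in> carrier R" "v a \<in> carrier R" if "a \<in> B" for a
      using uv that by auto
    have rc: "rel_map R B B' \<rho> u p \<in> carrier R" "rel_map R B B' \<rho> v p \<in> carrier R"
      if "p \<in> B'" for p
      by (rule PiE_mem[OF rel_map_closed[OF uv(1)] that] PiE_mem[OF rel_map_closed[OF uv(2)] that])+
    have "?L r = (\<Oplus>c\<in>B. if \<rho> c r then
        (\<Oplus>a\<in>B. \<Oplus>b\<in>B. if m a b = Some c then u a \<otimes> v b else \<zero>) else \<zero>)"
      using r B uv cu
      by (auto simp: rel_map_coeff basis_algebra_mult intro!: finsum_cong' finsum_closed)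
    also have "\<dots> = (\<Oplus>c\<in>B. \<Oplus>a\<in>B. \<Oplus>b\<in>B. if m a b = Some c \<and> \<rho> c r then u a \<otimes> v b else \<zero>)"
    proof (intro finsum_cong' refl)
      fix c
      show "(if \<rho> c r then (\<Oplus>a\<in>B. \<Oplus>b\<in>B. if m a b = Some c then u a \<otimes> v b else \<zero>) else \<zero>)
        = (\<Oplus>a\<in>B. \<Oplus>b\<in>B. if m a b = Some c \<and> \<rho> c r then u a \<otimes> v b else \<zero>)"
        by (cases "\<rho> c r") simp_all
    qed (use cu in \<open>auto intro!: finsum_closed\<close>)
    \<comment> \<open>The sum over \<open>c\<close> is moved innermost, where \<open>m a b\<close>
      leaves at most one index and \<open>finsum_delta\<close> applies.\<close>
    also have "\<dots> = (\<Oplus>a\<in>B. \<Oplus>c\<in>B. \<Oplus>b\<in>B. if m a b = Some c \<and> \<rho> c r then u a \<otimes> v b else \<zero>)"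
      using cu B by (intro finsum_swap_double) (auto intro!: finsum_closed)
    also have "\<dots> = (\<Oplus>a\<in>B. \<Oplus>b\<in>B. \<Oplus>c\<in>B. if m a b = Some c \<and> \<rho> c r then u a \<otimes> v b else \<zero>)"
      using cu B by (intro finsum_cong' finsum_swap_double) (auto intro!: finsum_closed)
    also have "\<dots> = (\<Oplus>a\<in>B. \<Oplus>b\<in>B. if \<exists>c\<in>B. m a b = Some c \<and> \<rho> c r then u a \<otimes> v b else \<zero>)"
      using cu B by (intro finsum_cong' finsum_delta) (auto intro!: finsum_closed)
    also have "\<dots> = (\<Oplus>a\<in>B. \<Oplus>b\<in>B. if \<exists>p\<in>B'. \<exists>q\<in>B'. m' p q = Some r \<and> \<rho> a p \<and> \<rho> b q
        then u a \<otimes> v b else \<zero>)"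
    proof (intro finsum_cong' refl)
      fix a b assume ab: "a \<in> B" "b \<in> B"
      show "(if \<exists>c\<in>B. m a b = Some c \<and> \<rho> c r then u a \<otimes> v b else \<zero>)
        = (if \<exists>p\<in>B'. \<exists>q\<in>B'. m' p q = Some r \<and> \<rho> a p \<and> \<rho> b q then u a \<otimes> v b else \<zero>)"
        unfolding ex[OF ab r, symmetric] using m_closed[OF ab] by auto
    qed (use cu in \<open>auto intro!: finsum_closed\<close>)
    \<comment> \<open>The existence statement is turned back into a sum, which \<open>unique\<close>
      permits, so that the sums over \<open>a\<close> and \<open>b\<close> can then be factored for
      fixed \<open>p\<close> and \<open>q\<close>.\<close>
    also have "\<dots> = (\<Oplus>a\<in>B. \<Oplus>b\<in>B. \<Oplus>p\<in>B'. \<Oplus>q\<in>B'.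
        if m' p q = Some r \<and> \<rho> a p \<and> \<rho> b q then u a \<otimes> v b else \<zero>)"
    proof (intro finsum_cong' refl)
      fix a b assume ab: "a \<in> B" "b \<in> B"
      show "(if \<exists>p\<in>B'. \<exists>q\<in>B'. m' p q = Some r \<and> \<rho> a p \<and> \<rho> b q then u a \<otimes> v b else \<zero>)
        = (\<Oplus>p\<in>B'. \<Oplus>q\<in>B'. if m' p q = Some r \<and> \<rho> a p \<and> \<rho> b q then u a \<otimes> v b else \<zero>)"
        using ab B cu unique[OF ab r] by (intro finsum_delta2[symmetric]) blast+
    qed (use cu in \<open>auto intro!: finsum_closed\<close>)
    also have "\<dots> = (\<Oplus>p\<in>B'. \<Oplus>q\<in>B'. \<Oplus>a\<in>B. \<Oplus>b\<in>B.
        if m' p q = Some r \<and> \<rho> a p \<and> \<rho> b q then u a \<otimes> v b else \<zero>)"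
      using cu B by (intro finsum_swap_pairs) auto
    also have "\<dots> = (\<Oplus>p\<in>B'. \<Oplus>q\<in>B'. if m' p q = Some r
        then rel_map R B B' \<rho> u p \<otimes> rel_map R B B' \<rho> v q else \<zero>)"
    proof (intro finsum_cong' refl)
      fix p q assume pq: "p \<in> B'" "q \<in> B'"
      have "rel_map R B B' \<rho> u p \<otimes> rel_map R B B' \<rho> v q
        = (\<Oplus>a\<in>B. (if \<rho> a p then u a else \<zero>) \<otimes> (\<Oplus>b\<in>B. if \<rho> b q then v b else \<zero>))"
        using pq B cu by (simp add: rel_map_coeff, intro finsum_ldistr) (auto intro!: finsum_closed)
      also have "\<dots> = (\<Oplus>a\<in>B. \<Oplus>b\<in>B. (if \<rho> a p then u a else \<zero>) \<otimes> (if \<rho> b q then v b else \<zero>))"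
        using pq B cu by (intro finsum_cong' finsum_rdistr) (auto intro!: finsum_closed)
      also have "\<dots> = (\<Oplus>a\<in>B. \<Oplus>b\<in>B. if \<rho> a p \<and> \<rho> b q then u a \<otimes> v b else \<zero>)"
        using cu by (intro finsum_cong') (auto intro!: finsum_closed)
      finally show "(\<Oplus>a\<in>B. \<Oplus>b\<in>B. if m' p q = Some r \<and> \<rho> a p \<and> \<rho> b q then u a \<otimes> v b else \<zero>)
        = (if m' p q = Some r then rel_map R B B' \<rho> u p \<otimes> rel_map R B B' \<rho> v q else \<zero>)"
        by (cases "m' p q = Some r") simp_all
    qed (use rc in \<open>auto intro!: finsum_closed\<close>)
    also have "\<dots> = ?M r"
      using uv B r by (intro basis_algebra_mult[symmetric] rel_map_closed)
    finally show ?thesis .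
  qed
qed

section \<open>Invertibility of a unitriangular 0-1 matrix\<close>

text \<open>Matching column \<open>p\<close> with row \<open>\<beta> p\<close> puts 1 on the
  diagonal, and the other nonzero entries of that row lie in columns of smaller rank
  \<open>d\<close>. Forward substitution along \<open>d\<close> therefore solves the system without
  any division. Together \<open>diag\<close> and \<open>tri\<close> force \<open>\<beta>\<close> to
  be injective: two points with one image would each have smaller rank than the other.\<close>

lemma rel_map_bij:
  fixes \<rho> :: "'x \<Rightarrow> 'y \<Rightarrow> bool" and d :: "'x \<Rightarrow> nat"
  assumes B: "finite B" and \<beta>: "\<beta> ` B = B'"
    and diag: "\<And>p. p \<in> B \<Longrightarrow> \<rho> p (\<beta> p)"
    and tri: "\<And>p p'. \<lbrakk>p \<in> B; p' \<in> B; \<rho> p' (\<beta> p)\<rbrakk> \<Longrightarrow> p' = p \<or> d p' < d p"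
  shows "bij_betw (rel_map R B B' \<rho>) (B \<rightarrow>\<^sub>E carrier R) (B' \<rightarrow>\<^sub>E carrier R)"
proof -
  let ?\<phi> = "rel_map R B B' \<rho>"
  define D where "D p = {p' \<in> B. d p' < d p \<and> \<rho> p' (\<beta> p)}" for p
  have D: "finite (D p)" "D p \<subseteq> B" "p \<notin> D p" for p using B by (auto simp: D_def)
  \<comment> \<open>Row \<open>\<beta> p\<close> of the matrix: by \<open>tri\<close> only
    \<open>p\<close> and the columns in \<open>D p\<close> contribute.\<close>
  have \<phi>: "?\<phi> u (\<beta> p) = u p \<oplus> (\<Oplus>p'\<in>D p. u p')" if u: "u \<in> B \<rightarrow> carrier R" and p: "p \<in> B" for u p
  proof -
    have "?\<phi> u (\<beta> p) = (\<Oplus>p'\<in>B. if \<rho> p' (\<beta> p) then u p' else \<zero>)"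
      using \<beta> p by (auto simp: rel_map_coeff)
    also have "\<dots> = (\<Oplus>p'\<in>insert p (D p). u p')"
      using B u p tri[OF p] diag[OF p]
      by (intro add.finprod_mono_neutral_cong_left[symmetric]) (auto simp: D_def)
    also have "\<dots> = u p \<oplus> (\<Oplus>p'\<in>D p. u p')"
      using D[of p] u p by (intro finsum_insert) auto
    finally show ?thesis .
  qed
  have inj: "inj_on ?\<phi> (B \<rightarrow>\<^sub>E carrier R)"
  proof (rule inj_onI)
    fix u v assume uv: "u \<in> B \<rightarrow>\<^sub>E carrier R" "v \<in> B \<rightarrow>\<^sub>E carrier R" and eq: "?\<phi> u = ?\<phi> v"
    have u: "u \<in> B \<rightarrow> carrier R" "v \<in> B \<rightarrow> carrier R" using uv by auto
    have "u p = v p" if "p \<in> B" for p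
      using that
    proof (induction "d p" arbitrary: p rule: less_induct)
      case less
      have "(\<Oplus>p'\<in>D p. u p') = (\<Oplus>p'\<in>D p. v p')"
        using less u by (intro finsum_cong') (auto simp: D_def)
      moreover have "u p \<oplus> (\<Oplus>p'\<in>D p. u p') = v p \<oplus> (\<Oplus>p'\<in>D p. v p')"
        using \<phi>[OF u(1) less.prems] \<phi>[OF u(2) less.prems] eq by simp
      moreover have "(\<Oplus>p'\<in>D p. v p') \<in> carrier R" "u p \<in> carrier R" "v p \<in> carrier R"
        using u D[of p] less.prems by (auto intro!: finsum_closed)
      ultimately show ?case by simp
    qed
    then show "u = v" using uv by (blast intro: PiE_ext)
  qed
  have surj: "w \<in> ?\<phi> ` (B \<rightarrow>\<^sub>E carrier R)" if w: "w \<in> B' \<rightarrow>\<^sub>E carrier R" for w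
  proof -
    \<comment> \<open>One step of forward substitution. Restricting \<open>u\<close> to
      \<open>D p\<close> makes the dependence on smaller ranks alone explicit, which is what
      well-founded recursion requires.\<close>
    define F where "F u p = w (\<beta> p) \<ominus> (\<Oplus>p'\<in>D p. restrict u (D p) p')" for u p
    define u where "u = wfrec (Wellfounded.measure d) F"
    have "adm_wf (Wellfounded.measure d) F"
    proof (unfold adm_wf_def, intro allI impI)
      fix f g :: "'x \<Rightarrow> 'a" and p
      assume "\<forall>z. (z, p) \<in> Wellfounded.measure d \<longrightarrow> f z = g z"
      then have "restrict f (D p) = restrict g (D p)"
        by (intro restrict_ext) (auto simp: D_def)
      then show "F f p = F g p" by (simp only: F_def)
    qed
    then have "u = F u" unfolding u_def by (intro wfrec_fixpoint) auto
    then have "u p = F u p" for p by (rule fun_cong)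
    then have uF: "u p = w (\<beta> p) \<ominus> (\<Oplus>p'\<in>D p. restrict u (D p) p')" for p
      unfolding F_def .
    have wc: "w (\<beta> p) \<in> carrier R" if "p \<in> B" for p using w \<beta> that by auto
    have uc: "u p \<in> carrier R" if "p \<in> B" for p
      using that
    proof (induction "d p" arbitrary: p rule: less_induct)
      case less
      then have "(\<Oplus>p'\<in>D p. restrict u (D p) p') \<in> carrier R"
        by (intro finsum_closed) (auto simp: D_def)
      then show ?case using wc[OF less.prems] uF[of p] by simp
    qed
    \<comment> \<open>The recursion defines \<open>u\<close> on the whole type, whereas vectors are
      extensional on \<open>B\<close>.\<close>
    let ?u = "restrict u B"
    have "?\<phi> ?u = w"
    proof (rule PiE_ext[OF rel_map_closed w])
      fix q assume "q \<in> B'"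
      then obtain p where p: "p \<in> B" "q = \<beta> p" using \<beta> by blast
      have s: "(\<Oplus>p'\<in>D p. restrict u (D p) p') = (\<Oplus>p'\<in>D p. ?u p')"
        using D[of p] uc by (intro finsum_cong') auto
      have sc: "(\<Oplus>p'\<in>D p. ?u p') \<in> carrier R"
        using D[of p] uc by (intro finsum_closed) auto
      have "?\<phi> ?u q = u p \<oplus> (\<Oplus>p'\<in>D p. ?u p')"
        using \<phi>[of ?u p] uc p by simp
      also have "\<dots> = w q"
        using uF[of p] s sc wc[OF p(1)] p by (simp add: a_assoc l_neg minus_eq)
      finally show "?\<phi> ?u q = w q" .
    qed (use uc in auto)
    moreover have "?u \<in> B \<rightarrow>\<^sub>E carrier R" using uc by auto
    ultimately show ?thesis by blast
  qed
  show ?thesis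
    unfolding bij_betw_def
    by (intro conjI inj equalityI image_subsetI rel_map_closed subsetI surj)
qed

end

section \<open>Partial cross-sections and ascents of Catalan maps\<close>

lemma catalanD:
  assumes "f \<in> carrier (catalan_monoid m)" "i \<in> {1..m}"
  shows catalan_in: "f i \<in> {1..m}" and catalan_ge: "i \<le> f i"
    and catalan_mono: "j \<in> {1..m} \<Longrightarrow> i \<le> j \<Longrightarrow> f i \<le> f j"
proof -
  have f: "f \<in> {1..m} \<rightarrow>\<^sub>E {1..m}" "mono_on {1..m} f" "\<forall>i\<in>{1..m}. i \<le> f i"
    using assms(1) by (simp_all add: catalan_monoid_def)
  show "f i \<in> {1..m}" using f(1) assms(2) by (rule PiE_mem)
  show "i \<le> f i" using f(3) assms(2) by (rule bspec)
  show "j \<in> {1..m} \<Longrightarrow> i \<le> j \<Longrightarrow> f i \<le> f j"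
    using monotone_onD[OF f(2) assms(2)] .
qed

lemma catalan_ext:
  assumes "f \<in> carrier (catalan_monoid m)" "g \<in> carrier (catalan_monoid m)"
    "\<And>i. i \<in> {1..m} \<Longrightarrow> f i = g i"
  shows "f = g"
proof (rule PiE_ext)
  show "f \<in> {1..m} \<rightarrow>\<^sub>E {1..m}" "g \<in> {1..m} \<rightarrow>\<^sub>E {1..m}"
    using assms(1,2) by (simp_all add: catalan_monoid_def)
qed (rule assms(3))

lemma catalan_finite: "finite (carrier (catalan_monoid m))"
proof (rule finite_subset)
  show "carrier (catalan_monoid m) \<subseteq> {1..m} \<rightarrow>\<^sub>E {1..m}"
    by (auto simp: catalan_monoid_def)
qed (auto intro: finite_PiE)

text \<open>If \<open>g\<close> sent an element of \<open>S\<close> to \<open>n + 1\<close>, so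
  would the composite, because \<open>f\<close> fixes \<open>n + 1\<close>. Hence a partial
  cross-section of the composite is carried by \<open>g\<close> into {1..n}, and injectivity splits
  between \<open>g\<close> on \<open>S\<close> and \<open>f\<close> on its image. This is the
  combinatorial form of multiplicativity.\<close>

lemma PCS_comp:
  assumes f: "f \<in> carrier (catalan_monoid (n + 1))" and g: "g \<in> carrier (catalan_monoid (n + 1))"
  shows "S \<in> PCS n (f \<otimes>\<^bsub>catalan_monoid (n + 1)\<^esub> g) \<longleftrightarrow> S \<in> PCS n g \<and> g ` S \<in> PCS n f"
    and "S \<in> PCS n g \<Longrightarrow> (f \<otimes>\<^bsub>catalan_monoid (n + 1)\<^esub> g) ` S = f ` g ` S"
proof -
  have fg: "(f \<otimes>\<^bsub>catalan_monoid (n + 1)\<^esub> g) i = f (g i)" if "i \<in> {1..n}" for i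
    using that by (simp add: catalan_monoid_def compose_def)
  have top: "f (n + 1) = n + 1"
    using catalan_in[OF f, of "n + 1"] catalan_ge[OF f, of "n + 1"] by auto
  have im: "(f \<otimes>\<^bsub>catalan_monoid (n + 1)\<^esub> g) ` S = f ` g ` S" if "S \<subseteq> {1..n}"
    unfolding image_image using that fg by (intro image_cong) auto
  have inj: "inj_on (f \<otimes>\<^bsub>catalan_monoid (n + 1)\<^esub> g) S \<longleftrightarrow> inj_on g S \<and> inj_on f (g ` S)"
    if "S \<subseteq> {1..n}"
  proof -
    have "inj_on (f \<otimes>\<^bsub>catalan_monoid (n + 1)\<^esub> g) S \<longleftrightarrow> inj_on (f \<circ> g) S"
      using that fg by (intro inj_on_cong) auto
    then show ?thesis by (auto intro: comp_inj_on dest: inj_on_imageI inj_on_imageI2)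
  qed
  have sub: "g ` S \<subseteq> {1..n}" if "S \<subseteq> {1..n}" "n + 1 \<notin> f ` g ` S"
  proof
    fix y assume y: "y \<in> g ` S"
    then obtain i where i: "i \<in> S" "y = g i" by blast
    have "y \<noteq> n + 1" using y that(2) top by (metis image_eqI)
    then show "y \<in> {1..n}" using catalan_in[OF g, of i] i that by auto
  qed
  show "S \<in> PCS n (f \<otimes>\<^bsub>catalan_monoid (n + 1)\<^esub> g) \<longleftrightarrow> S \<in> PCS n g \<and> g ` S \<in> PCS n f"
  proof (cases "S \<subseteq> {1..n}")
    case True
    have "n + 1 \<notin> g ` S" if "n + 1 \<notin> f ` g ` S" using sub[OF True that] by auto
    then show ?thesis
      using sub[OF True] True unfolding PCS_def mem_Collect_eq im[OF True] inj[OF True] by blast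
  qed (simp add: PCS_def)
  show "S \<in> PCS n g \<Longrightarrow> (f \<otimes>\<^bsub>catalan_monoid (n + 1)\<^esub> g) ` S = f ` g ` S"
    using im by (simp add: PCS_def)
qed

section \<open>Ascents and the pointwise order\<close>

text \<open>With \<open>i \<le> n\<close> the argument \<open>Suc i\<close> stays in the domain
  {1..n+1}. The index \<open>n + 1\<close> is left out, being the maximum of the fibre over the
  forbidden value \<open>n + 1\<close>.\<close>

definition ascents :: "nat \<Rightarrow> (nat \<Rightarrow> nat) \<Rightarrow> nat set" where
  "ascents n f = {i \<in> {1..n}. f i < f (Suc i)}"

text \<open>By monotonicity a jump at \<open>i\<close> separates \<open>f i\<close> from all later
  values. This gives injectivity, and comparison with the value at \<open>n + 1\<close> gives
  \<open>f i < n + 1\<close>.\<close>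

lemma ascents_PCS:
  assumes f: "f \<in> carrier (catalan_monoid (n + 1))"
  shows "ascents n f \<in> PCS n f"
proof -
  have lt: "f i < f j" if "i \<in> ascents n f" "j \<in> {1..n+1}" "i < j" for i j
    using that catalan_mono[OF f, of "Suc i" j] by (auto simp: ascents_def)
  have "f i < n + 1" if "i \<in> ascents n f" for i
    using lt[OF that, of "n + 1"] catalan_in[OF f, of "n + 1"] that by (auto simp: ascents_def)
  moreover have "inj_on f (ascents n f)"
  proof (rule linorder_inj_onI)
    fix i j assume "i < j" "i \<in> ascents n f" "j \<in> ascents n f"
    then show "f i \<noteq> f j" using lt[of i j] by (auto simp: ascents_def)
  qed (use linear in blast)
  ultimately show ?thesis by (fastforce simp: PCS_def ascents_def)
qed

text \<open>A monotone map that is injective on \<open>S\<close> is strictly increasing there.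
  Consequently \<open>S\<close> and its image together determine \<open>f\<close> on
  \<open>S\<close>.\<close>

lemma PCS_sorted_image:
  assumes f: "f \<in> carrier (catalan_monoid (n + 1))" and S: "S \<in> PCS n f"
  shows "sorted_list_of_set (f ` S) = map f (sorted_list_of_set S)"
proof -
  have fin: "finite S" and sub: "S \<subseteq> {1..n}" and inj: "inj_on f S"
    using S finite_subset by (auto simp: PCS_def)
  have "sorted_wrt (<) (map f (sorted_list_of_set S))"
  proof (unfold sorted_wrt_map, rule sorted_wrt_mono_rel[OF _ strict_sorted_list_of_set[of S]])
    fix x y assume "x \<in> set (sorted_list_of_set S)" "y \<in> set (sorted_list_of_set S)" "x < y"
    moreover from this have "f x \<le> f y"
      using fin sub by (intro catalan_mono[OF f]) auto
    ultimately show "f x < f y"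
      using fin inj by (auto simp: inj_on_def le_less)
  qed
  then show ?thesis
    using fin by (intro strict_sorted_equal strict_sorted_list_of_set) simp_all
qed

text \<open>This is the triangularity of the matrix. The maps \<open>f\<close> and \<open>g\<close>
  agree on the ascents of \<open>f\<close>, since sorted enumerations correspond. Going down from
  \<open>n + 1\<close>, at a non-ascent \<open>k\<close> the value of \<open>f\<close> at
  \<open>k\<close> equals that at \<open>k + 1\<close>, while \<open>g\<close> can only
  decrease.\<close>

lemma le_of_image_ascents:
  assumes f: "f \<in> carrier (catalan_monoid (n + 1))" and g: "g \<in> carrier (catalan_monoid (n + 1))"
    and S: "ascents n f \<in> PCS n g" and im: "g ` ascents n f = f ` ascents n f"
    and i: "i \<in> {1..n + 1}"
  shows "g i \<le> f i"
proof -
  have "map g (sorted_list_of_set (ascents n f)) = map f (sorted_list_of_set (ascents n f))"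
    using PCS_sorted_image[OF f ascents_PCS[OF f]] PCS_sorted_image[OF g S] im by simp
  then have eq: "g j = f j" if "j \<in> ascents n f" for j
    using that by (auto simp: ascents_def)
  have "i \<le> n + 1" using i by simp
  \<comment> \<open>The induction runs downwards from \<open>n + 1\<close>; the guard keeps its
    index inside the domain.\<close>
  then have "1 \<le> i \<longrightarrow> g i \<le> f i"
  proof (induction rule: inc_induct)
    case base
    show ?case
      using catalan_in[OF g, of "n + 1"] catalan_ge[OF f, of "n + 1"] by auto
  next
    case (step k)
    show ?case
    proof
      assume k: "1 \<le> k"
      show "g k \<le> f k"
      proof (cases "k \<in> ascents n f")
        case True
        then show ?thesis using eq by simp
      next
        case False
        then have "f (Suc k) \<le> f k" using k step.hyps by (auto simp: ascents_def)
        moreover have "g k \<le> g (Suc k)" using k step.hyps by (intro catalan_mono[OF g]) auto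
        ultimately show ?thesis using step.IH by linarith
      qed
    qed
  qed
  then show ?thesis using i by simp
qed

section \<open>The Catalan map with prescribed ascents and values on them\<close>

text \<open>With positions counted from 0, the number of elements below \<open>i\<close> is the
  position of the least element that is at least \<open>i\<close>. This gives the witness in
  \<open>ex_catalan_of_pair\<close> a closed formula.\<close>

lemma card_less_nth:
  fixes S :: "nat set"
  assumes "finite S"
  shows "c < card S \<Longrightarrow> card {s \<in> S. s < sorted_list_of_set S ! c} = c"
    and "card {s \<in> S. s < i} < card S \<Longrightarrow> i \<le> sorted_list_of_set S ! card {s \<in> S. s < i}"
proof -
  let ?l = "sorted_list_of_set S"
  have len: "length ?l = card S" by simp
  have lt: "?l ! a < ?l ! b" if "a < b" "b < card S" for a b
    using sorted_wrt_nth_less[OF strict_sorted_list_of_set that(1)] that(2) by simp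
  have S: "S = (!) ?l ` {..<card S}"
    using set_sorted_list_of_set[OF assms] len by (metis atLeast_upt list.set_map map_nth)
  have inj: "inj_on ((!) ?l) {..<card S}"
    by (simp add: inj_on_nth)
  show "card {s \<in> S. s < ?l ! c} = c" if c: "c < card S" for c
  proof -
    have "{s \<in> S. s < ?l ! c} = (!) ?l ` {..<c}"
    proof (intro equalityI subsetI)
      fix s assume s: "s \<in> {s \<in> S. s < ?l ! c}"
      then obtain b where b: "s = ?l ! b" "b < card S" using S by blast
      then have "b < c" using s lt[of c b] by (metis linorder_less_linear mem_Collect_eq not_less_iff_gr_or_eq)
      then show "s \<in> (!) ?l ` {..<c}" using b by blast
    next
      fix s assume "s \<in> (!) ?l ` {..<c}"
      then obtain b where "s = ?l ! b" "b < c" by blast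
      then show "s \<in> {s \<in> S. s < ?l ! c}" using c lt[of b c] S by auto
    qed
    moreover have "inj_on ((!) ?l) {..<c}" using inj_on_subset[OF inj] c by auto
    ultimately show ?thesis by (simp add: card_image)
  qed
  then have card: "card {s \<in> S. s < ?l ! c} = c" if "c < card S" for c using that .
  show "i \<le> ?l ! card {s \<in> S. s < i}" if c: "card {s \<in> S. s < i} < card S"
  proof (rule ccontr)
    let ?c = "card {s \<in> S. s < i}"
    assume i: "\<not> i \<le> ?l ! ?c"
    \<comment> \<open>If the entry at position \<open>?c\<close> were below \<open>i\<close>, it
      would be counted by \<open>?c\<close> but not be below itself. Fewer than \<open>?c\<close>
      elements would then precede it, against the first part.\<close>
    have psub: "card {s \<in> S. s < t} < ?c" if "t \<in> S" "t < i" for t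
      using assms that by (intro psubset_card_mono) auto
    have "?l ! ?c \<in> S" using nth_mem[of ?c ?l] c assms by simp
    from psub[OF this] i have "card {s \<in> S. s < ?l ! ?c} < ?c" by simp
    then show False unfolding card[OF c] by (rule less_irrefl[THEN notE])
  qed
qed

text \<open>
  The witness is the largest Catalan map inducing the order isomorphism \<open>S \<rightarrow> T\<close>: it sends \<open>i\<close>
  to the image of the least element of \<open>S\<close> that is \<open>\<ge> i\<close>, and to \<open>n + 1\<close> if there is none.
\<close>

lemma ex_catalan_of_pair:
  assumes ST: "(S, T) \<in> incidence_pairs (subset_poset n)"
  shows "\<exists>f\<in>carrier (catalan_monoid (n + 1)). ascents n f = S \<and> f ` S = T"
proof -
  have sub: "S \<subseteq> {1..n}" "T \<subseteq> {1..n}" and card: "card S = card T"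
    and le: "\<And>c. c < card S \<Longrightarrow> sorted_list_of_set S ! c \<le> sorted_list_of_set T ! c"
    using ST by (auto simp: incidence_pairs_def subset_poset_def)
  have fin: "finite S" "finite T" using sub finite_subset by auto
  \<comment> \<open>The appended entry \<open>n + 1\<close> has position \<open>card S\<close>,
    which is \<open>c i\<close> exactly when every element of \<open>S\<close> lies below
    \<open>i\<close>.\<close>
  define l where "l = sorted_list_of_set T @ [n + 1]"
  define c where "c i = card {s \<in> S. s < i}" for i
  define f where "f = (\<lambda>i\<in>{1..n + 1}. l ! c i)"
  have c_le: "c i \<le> card S" for i
    unfolding c_def using fin by (intro card_mono) auto
  have c_mono: "c i \<le> c j" if "i \<le> j" for i j
    unfolding c_def using fin that by (intro card_mono) auto
  \<comment> \<open>The counter moves exactly at the elements of \<open>S\<close>. As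
    \<open>l\<close> is strictly increasing, these become the ascents of \<open>f\<close>.\<close>
  have c_Suc: "c (Suc i) = (if i \<in> S then Suc (c i) else c i)" for i
  proof -
    have "{s \<in> S. s < Suc i} = {s \<in> S. s < i} \<union> (if i \<in> S then {i} else {})"
      by (auto simp: less_Suc_eq)
    then show ?thesis using fin by (simp add: c_def)
  qed
  have l_lt: "l ! a < l ! b" if "a < b" "b \<le> card S" for a b
  proof -
    have "sorted_wrt (<) l"
      unfolding l_def sorted_wrt_append using sub fin by (auto simp: less_Suc_eq_le)
    from sorted_wrt_nth_less[OF this that(1)] show ?thesis using that(2) card by (simp add: l_def)
  qed
  have l_top: "l ! card S = n + 1"
    using card by (simp add: l_def nth_append)
  have l_T: "l ! a = sorted_list_of_set T ! a" if "a < card S" for a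
    using that card by (simp add: l_def nth_append)
  have l_in: "l ! a \<le> n + 1" if "a \<le> card S" for a
    using l_lt[of a "card S"] l_top that by (cases "a = card S") auto
  \<comment> \<open>Here the order of the poset enters: the least \<open>s\<close> in
    \<open>S\<close> with \<open>i \<le> s\<close> is at most its partner in \<open>T\<close>. If
    there is no such \<open>s\<close>, the value is \<open>n + 1\<close>.\<close>
  have ge: "i \<le> l ! c i" if "i \<in> {1..n + 1}" for i
  proof (cases "c i < card S")
    case True
    then show ?thesis
      using card_less_nth(2)[OF fin(1), of i] le[OF True] l_T[OF True] by (simp add: c_def)
  next
    case False
    then show ?thesis using c_le[of i] l_top that by simp
  qed
  have "f \<in> carrier (catalan_monoid (n + 1))"
  proof -
    have "mono_on {1..n + 1} f"
    proof (rule monotone_onI)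
      fix i j assume "i \<in> {1..n + 1}" "j \<in> {1..n + 1}" "i \<le> j"
      then show "f i \<le> f j"
        using c_mono[of i j] l_lt[of "c i" "c j"] c_le[of j]
        by (cases "c i = c j") (auto simp: f_def)
    qed
    moreover have "f \<in> {1..n + 1} \<rightarrow>\<^sub>E {1..n + 1}"
      using ge l_in[OF c_le] by (fastforce simp: f_def)
    ultimately show ?thesis using ge by (simp add: catalan_monoid_def f_def)
  qed
  moreover have "ascents n f = S"
  proof -
    have "f i < f (Suc i) \<longleftrightarrow> i \<in> S" if "i \<in> {1..n}" for i
      using that l_lt[of "c i" "c (Suc i)"] c_le[of "Suc i"] by (auto simp: f_def c_Suc)
    then show ?thesis using sub by (auto simp: ascents_def)
  qed
  moreover have "f ` S = T"
  proof -
    have S: "S = (!) (sorted_list_of_set S) ` {..<card S}"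
      and T: "T = (!) (sorted_list_of_set T) ` {..<card S}"
      using fin card by (metis atLeast_upt length_sorted_list_of_set list.set_map map_nth
          set_sorted_list_of_set)+
    have "f (sorted_list_of_set S ! a) = sorted_list_of_set T ! a" if a: "a < card S" for a
    proof -
      have "sorted_list_of_set S ! a \<in> S" using S a by blast
      then show ?thesis
        using sub card_less_nth(1)[OF fin(1) a] l_T[OF a] by (auto simp: f_def c_def)
    qed
    then have "f ` (!) (sorted_list_of_set S) ` {..<card S} = (!) (sorted_list_of_set T) ` {..<card S}"
      unfolding image_image by (intro image_cong) auto
    then show ?thesis using S T by simp
  qed
  ultimately show ?thesis by blast
qed

section \<open>The isomorphism\<close>

theorem theorem3p1:
  fixes R :: "('r, 's) ring_scheme" and n :: nat
  assumes "cring R"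
  shows "\<exists>\<phi>. algebra_iso R (monoid_algebra R (catalan_monoid (n + 1)))
                           (incidence_algebra R (subset_poset n)) \<phi> \<and>
             (\<forall>f\<in>carrier (catalan_monoid (n + 1)).
                \<phi> (basis_vec R (carrier (catalan_monoid (n + 1))) f) =
                (\<Oplus>\<^bsub>incidence_algebra R (subset_poset n)\<^esub>S\<in>PCS n f.
                   basis_vec R (incidence_pairs (subset_poset n)) (S, f ` S)))"
proof -
  interpret cring R by fact
  let ?M = "catalan_monoid (n + 1)"
  let ?B = "carrier ?M" and ?I = "incidence_pairs (subset_poset n)"
  let ?m = "\<lambda>a b. Some (a \<otimes>\<^bsub>?M\<^esub> b)"
    and ?m' = "\<lambda>(U, V) (X, Y). if Y = U then Some (X, V) else None"
  let ?e = "basis_vec R ?B \<one>\<^bsub>?M\<^esub>" and ?e' = "\<lambda>(X, Y)\<in>?I. if X = Y then \<one>\<^bsub>R\<^esub> else \<zero>\<^bsub>R\<^esub>"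
  let ?A = "basis_algebra R ?B ?m ?e" and ?A' = "basis_algebra R ?I ?m' ?e'"
  \<comment> \<open>The relation holds when the pair \<open>q\<close> occurs in the prescribed sum
    for \<open>f\<close>.\<close>
  define \<rho> where "\<rho> f q \<longleftrightarrow> fst q \<in> PCS n f \<and> f ` fst q = snd q" for f and q :: "nat set \<times> nat set"
  define \<phi> where "\<phi> = rel_map R ?B ?I \<rho>"
  interpret M: monoid ?M by (rule catalan_monoid_monoid)
  have A: "monoid_algebra R ?M = ?A" and A': "incidence_algebra R (subset_poset n) = ?A'"
    by (simp_all add: monoid_algebra_def incidence_algebra_def)
  have finB: "finite ?B" by (rule catalan_finite)
  have finI: "finite ?I"
  proof (rule finite_subset)
    show "?I \<subseteq> Pow {1..n} \<times> Pow {1..n}" by (auto simp: incidence_pairs_def subset_poset_def)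
  qed simp
  have algA: "assoc_algebra R ?A"
    using monoid_algebra_assoc_algebra[OF assms M.monoid_axioms] A by simp
  have algA': "assoc_algebra R ?A'"
    using incidence_algebra_assoc_algebra[OF assms subset_poset_partial_order[of n]] A'
    by (simp add: subset_poset_def)
  have abA': "abelian_monoid ?A'"
    using algA' by (intro abelian_group.axioms ring.is_abelian_group assoc_algebra.axioms(2))
  have mult: "\<phi> (u \<otimes>\<^bsub>?A\<^esub> v) = \<phi> u \<otimes>\<^bsub>?A'\<^esub> \<phi> v"
    if "u \<in> ?B \<rightarrow>\<^sub>E carrier R" "v \<in> ?B \<rightarrow>\<^sub>E carrier R" for u v
    unfolding \<phi>_def
  proof (rule rel_map_mult[OF finB finI that])
    show "c \<in> ?B" if "a \<in> ?B" "b \<in> ?B" "?m a b = Some c" for a b c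
      using M.m_closed[OF that(1,2)] that(3) by simp
  next
    fix a b r assume ab: "a \<in> ?B" "b \<in> ?B" and r: "r \<in> ?I"
    obtain S T where ST: "r = (S, T)" by (cases r)
    have "\<rho> (a \<otimes>\<^bsub>?M\<^esub> b) r \<longleftrightarrow> S \<in> PCS n b \<and> b ` S \<in> PCS n a \<and> a ` b ` S = T"
      unfolding \<rho>_def ST fst_conv snd_conv PCS_comp(1)[OF ab] using PCS_comp(2)[OF ab] by auto
    \<comment> \<open>Factoring \<open>(S, T)\<close> in the incidence algebra means choosing a
      middle set, and \<open>\<rho> b q\<close> forces it to be the image of \<open>S\<close> under
      \<open>b\<close>. The same remark yields uniqueness.\<close>
    also have "\<dots> \<longleftrightarrow> (\<exists>p\<in>?I. \<exists>q\<in>?I. ?m' p q = Some r \<and> \<rho> a p \<and> \<rho> b q)"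
    proof
      assume h: "S \<in> PCS n b \<and> b ` S \<in> PCS n a \<and> a ` b ` S = T"
      then have "(b ` S, T) \<in> ?I" "(S, b ` S) \<in> ?I"
        using PCS_incidence_pairs ab by blast+
      then show "\<exists>p\<in>?I. \<exists>q\<in>?I. ?m' p q = Some r \<and> \<rho> a p \<and> \<rho> b q"
        using h by (intro bexI[of _ "(b ` S, T)"] bexI[of _ "(S, b ` S)"]) (auto simp: \<rho>_def ST)
    qed (auto simp: \<rho>_def ST split: if_splits)
    finally show "(\<exists>c. ?m a b = Some c \<and> \<rho> c r)
      \<longleftrightarrow> (\<exists>p\<in>?I. \<exists>q\<in>?I. ?m' p q = Some r \<and> \<rho> a p \<and> \<rho> b q)" by simp
  qed (auto simp: \<rho>_def split: if_splits)
  \<comment> \<open>Every subset of {1..n} is a partial cross-section of the identity and equals its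
    own image, so exactly the diagonal pairs occur.\<close>
  have one: "\<phi> ?e = ?e'"
  proof
    fix q show "\<phi> ?e q = ?e' q"
    proof (cases "q \<in> ?I")
      case True
      obtain S T where ST: "q = (S, T)" by (cases q)
      have S: "S \<subseteq> {1..n}" using True by (auto simp: ST incidence_pairs_def subset_poset_def)
      then have id: "\<one>\<^bsub>?M\<^esub> i = i" if "i \<in> S" for i using that by (auto simp: catalan_monoid_def)
      then have "\<one>\<^bsub>?M\<^esub> ` S = S" by simp
      moreover have "inj_on \<one>\<^bsub>?M\<^esub> S" using id by (auto simp: inj_on_def)
      ultimately have "\<rho> \<one>\<^bsub>?M\<^esub> q \<longleftrightarrow> S = T" using S by (auto simp: \<rho>_def ST PCS_def)
      then show ?thesis
        unfolding \<phi>_def rel_map_basis_vec[OF finB M.one_closed True] using True by (simp add: ST)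
    qed (simp add: \<phi>_def rel_map_def)
  qed
  have bij: "bij_betw \<phi> (?B \<rightarrow>\<^sub>E carrier R) (?I \<rightarrow>\<^sub>E carrier R)"
    unfolding \<phi>_def
  proof (rule rel_map_bij[OF finB])
    \<comment> \<open>This map plays the part of \<open>\<beta>\<close>, attaching to each
      \<open>f\<close> its diagonal entry.\<close>
    show "(\<lambda>f. (ascents n f, f ` ascents n f)) ` ?B = ?I"
      using PCS_incidence_pairs ascents_PCS ex_catalan_of_pair by (fastforce simp: image_iff)
    show "\<rho> f (ascents n f, f ` ascents n f)" if "f \<in> ?B" for f
      using ascents_PCS[OF that] by (simp add: \<rho>_def)
    fix f g assume fg: "f \<in> ?B" "g \<in> ?B" and "\<rho> g (ascents n f, f ` ascents n f)"
    then have le: "g i \<le> f i" if "i \<in> {1..n + 1}" for i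
      using le_of_image_ascents that by (auto simp: \<rho>_def)
    \<comment> \<open>The rank \<open>d\<close> is the sum of all values: it strictly drops when a
      map is replaced by a different one that is pointwise smaller or equal.\<close>
    show "g = f \<or> (\<Sum>i\<in>{1..n + 1}. g i) < (\<Sum>i\<in>{1..n + 1}. f i)"
    proof (cases "\<forall>i\<in>{1..n + 1}. g i = f i")
      case True
      then show ?thesis using catalan_ext fg by blast
    next
      case False
      then have "\<exists>i\<in>{1..n + 1}. g i < f i" using le by (meson le_neq_implies_less)
      then show ?thesis using le by (intro disjI2 sum_strict_mono_ex1) auto
    qed
  qed
  have carrier: "carrier ?A = ?B \<rightarrow>\<^sub>E carrier R" "carrier ?A' = ?I \<rightarrow>\<^sub>E carrier R"
    by (rule basis_algebra_carrier[OF finB], rule basis_algebra_carrier[OF finI])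
  have "\<phi> \<in> ring_iso ?A ?A'"
  proof (rule ring_iso_memI)
    show "\<phi> u \<in> carrier ?A'" if "u \<in> carrier ?A" for u
      using that unfolding carrier \<phi>_def by (rule rel_map_closed)
    show "\<phi> (u \<otimes>\<^bsub>?A\<^esub> v) = \<phi> u \<otimes>\<^bsub>?A'\<^esub> \<phi> v"
      if "u \<in> carrier ?A" "v \<in> carrier ?A" for u v
      using that unfolding carrier by (rule mult)
    show "\<phi> (u \<oplus>\<^bsub>?A\<^esub> v) = \<phi> u \<oplus>\<^bsub>?A'\<^esub> \<phi> v"
      if "u \<in> carrier ?A" "v \<in> carrier ?A" for u v
      using that unfolding carrier \<phi>_def by (rule rel_map_add[OF finB finI])
    show "\<phi> \<one>\<^bsub>?A\<^esub> = \<one>\<^bsub>?A'\<^esub>" using one by (simp add: basis_algebra_def)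
    show "bij_betw \<phi> (carrier ?A) (carrier ?A')" using bij unfolding carrier .
  qed
  moreover have "\<phi> (r \<odot>\<^bsub>?A\<^esub> u) = r \<odot>\<^bsub>?A'\<^esub> \<phi> u" if "r \<in> carrier R" "u \<in> carrier ?A" for r u
    using that unfolding carrier \<phi>_def by (intro rel_map_smult[OF finB])
  ultimately have "algebra_iso R ?A ?A' \<phi>"
    using algA algA' by (simp add: algebra_iso_def)
  moreover have "\<phi> (basis_vec R ?B f) = (\<Oplus>\<^bsub>?A'\<^esub>S\<in>PCS n f. basis_vec R ?I (S, f ` S))"
    if f: "f \<in> ?B" for f
  proof (rule PiE_ext)
    show "\<phi> (basis_vec R ?B f) \<in> ?I \<rightarrow>\<^sub>E carrier R"
      unfolding \<phi>_def by (rule rel_map_closed[OF basis_vec_closed])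
    show "(\<Oplus>\<^bsub>?A'\<^esub>S\<in>PCS n f. basis_vec R ?I (S, f ` S)) \<in> ?I \<rightarrow>\<^sub>E carrier R"
      unfolding carrier(2)[symmetric]
      by (intro abelian_monoid.finsum_closed[OF abA'] funcsetI) (unfold carrier, rule basis_vec_closed)
    fix q assume q: "q \<in> ?I"
    have fin: "finite (PCS n f)"
      by (rule finite_subset[of _ "Pow {1..n}"]) (auto simp: PCS_def)
    have "(\<Oplus>\<^bsub>?A'\<^esub>S\<in>PCS n f. basis_vec R ?I (S, f ` S)) q
        = (\<Oplus>\<^bsub>R\<^esub>S\<in>PCS n f. basis_vec R ?I (S, f ` S) q)"
      by (rule basis_algebra_finsum[OF finI abA' fin basis_vec_closed q])
    also have "\<dots> = (\<Oplus>\<^bsub>R\<^esub>S\<in>PCS n f. if q = (S, f ` S) then \<one>\<^bsub>R\<^esub> else \<zero>\<^bsub>R\<^esub>)"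
      using q by (simp add: basis_vec_def)
    \<comment> \<open>Only the first component of \<open>q\<close> can serve as \<open>S\<close>, so
      at most one summand is nonzero.\<close>
    also have "\<dots> = (if \<exists>S\<in>PCS n f. q = (S, f ` S) then \<one>\<^bsub>R\<^esub> else \<zero>\<^bsub>R\<^esub>)"
      using fin by (intro finsum_delta) auto
    also have "\<dots> = \<phi> (basis_vec R ?B f) q"
      unfolding \<phi>_def rel_map_basis_vec[OF finB f q] by (cases q) (auto simp: \<rho>_def)
    finally show "\<phi> (basis_vec R ?B f) q
      = (\<Oplus>\<^bsub>?A'\<^esub>S\<in>PCS n f. basis_vec R ?I (S, f ` S)) q" by simp
  qed
  ultimately show ?thesis unfolding A A' by blast
qed

end
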